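(* Fix a constant bound $c$ on the maximum degree. There is a randomized algorithm running in expected polynomial time that, given a graph $G$ with $n$ nodes and maximum degree at most $c$, outputs an instance of the Binary Partial Coding Problem with $O(n)$ symbols and $O(\log^2 n)$ attributes which admits a feasible encoding if and only if $G$ admits a proper $3$-coloring.
   Context: A proper $k$-coloring of a graph $G=(V,E)$ assigns one of $k$ colors to each node such that adjacent nodes get distinct colors. Binary Partial Coding Problem: given $d$ binary attributes (values in $\{0,1\}$) and symbols $s_1,\ldots,s_n\subseteq\{1,\ldots,d\}$, an encoding of $s_j$ is a map $c_j:s_j\to\{0,1\}$; encodings are feasible if for every $j\ne k$ there is $i\in s_j\cap s_k$ with $c_j(i)\ne c_k(i)$; decide whether a feasible encoding exists. *)

theory Defs
  imports
    "HOL-Probability.Probability"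
    "HOL-Computational_Algebra.Polynomial"
    "HOL-Library.Landau_Symbols"
    "HOL-Library.FuncSet"
begin

section \<open>Randomized algorithms\<close>

text \<open>
  The machine model is first-order pure LISP with fair coin flips. Data are binary trees; an
  algorithm is a finite list of (mutually recursive) function bodies together with a main expression.
  Arguments are passed by value, and a variable is a de Bruijn index into the environment.
\<close>

datatype sexp = Leaf | Node sexp sexp

fun left :: "sexp \<Rightarrow> sexp" where
  "left Leaf = Leaf"
| "left (Node a b) = a"

fun right :: "sexp \<Rightarrow> sexp" where
  "right Leaf = Leaf"
| "right (Node a b) = b"

datatype expr =
    EVar nat
  | ELeaf
  | ENode expr expr
  | ELeft expr
  | ERight expr
  | EIf expr expr expr
  | ELet expr expr
  | ECall nat "expr list"
  | EFlip

type_synonym algorithm = "expr list \<times> expr"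

type_synonym coins = "bool stream"

text \<open>
  \<open>eval D env e \<omega> v t \<omega>'\<close>: with function bodies \<open>D\<close>, the expression \<open>e\<close> evaluates in \<open>env\<close> to \<open>v\<close> in
  \<open>t\<close> steps, consuming the coins of \<open>\<omega>\<close> up to the remainder \<open>\<omega>'\<close>. As there is a derivation only
  for terminating evaluations, a diverging (or stuck) computation is one without a derivation.
  In conditionals, \<open>Leaf\<close> is false and every other tree is true.

  Every rule costs one step. This is realistic up to a polynomial: with trees kept as pointers to
  shared cells, each rule takes constant time (for a fixed algorithm) on a pointer machine and
  allocates at most one cell.
\<close>

inductive
  eval :: "expr list \<Rightarrow> sexp list \<Rightarrow> expr \<Rightarrow> coins \<Rightarrow> sexp \<Rightarrow> nat \<Rightarrow> coins \<Rightarrow> bool" and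
  evals :: "expr list \<Rightarrow> sexp list \<Rightarrow> expr list \<Rightarrow> coins \<Rightarrow> sexp list \<Rightarrow> nat \<Rightarrow> coins \<Rightarrow> bool"
  for D :: "expr list"
where
  Var: "i < length env \<Longrightarrow> eval D env (EVar i) \<omega> (env ! i) 1 \<omega>"
| Leaf: "eval D env ELeaf \<omega> Leaf 1 \<omega>"
| Node: "eval D env e1 \<omega> v1 t1 \<omega>1 \<Longrightarrow> eval D env e2 \<omega>1 v2 t2 \<omega>2 \<Longrightarrow>
    eval D env (ENode e1 e2) \<omega> (Node v1 v2) (t1 + t2 + 1) \<omega>2"
| Left: "eval D env e \<omega> v t \<omega>1 \<Longrightarrow> eval D env (ELeft e) \<omega> (left v) (t + 1) \<omega>1"
| Right: "eval D env e \<omega> v t \<omega>1 \<Longrightarrow> eval D env (ERight e) \<omega> (right v) (t + 1) \<omega>1"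
| If: "eval D env b \<omega> v t \<omega>1 \<Longrightarrow> eval D env (if v \<noteq> Leaf then e1 else e2) \<omega>1 v' t' \<omega>2 \<Longrightarrow>
    eval D env (EIf b e1 e2) \<omega> v' (t + t' + 1) \<omega>2"
| Let: "eval D env e1 \<omega> v1 t1 \<omega>1 \<Longrightarrow> eval D (v1 # env) e2 \<omega>1 v2 t2 \<omega>2 \<Longrightarrow>
    eval D env (ELet e1 e2) \<omega> v2 (t1 + t2 + 1) \<omega>2"
| Call: "evals D env es \<omega> vs t \<omega>1 \<Longrightarrow> f < length D \<Longrightarrow> eval D vs (D ! f) \<omega>1 v t' \<omega>2 \<Longrightarrow>
    eval D env (ECall f es) \<omega> v (t + t' + 1) \<omega>2"
| Flip: "eval D env EFlip \<omega> (if shd \<omega> then Node Leaf Leaf else Leaf) 1 (stl \<omega>)"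
| Nil: "evals D env [] \<omega> [] 0 \<omega>"
| Cons: "eval D env e \<omega> v t \<omega>1 \<Longrightarrow> evals D env es \<omega>1 vs t' \<omega>2 \<Longrightarrow>
    evals D env (e # es) \<omega> (v # vs) (t + t') \<omega>2"

definition returns :: "algorithm \<Rightarrow> sexp \<Rightarrow> coins \<Rightarrow> sexp \<Rightarrow> nat \<Rightarrow> bool" where
  "returns A x \<omega> v t \<longleftrightarrow> (\<exists>\<omega>'. eval (fst A) [x] (snd A) \<omega> v t \<omega>')"

definition outputs :: "algorithm \<Rightarrow> sexp \<Rightarrow> sexp \<Rightarrow> bool" where
  "outputs A x v \<longleftrightarrow> (\<exists>\<omega> t. returns A x \<omega> v t)"

definition coin_space :: "coins measure" where
  "coin_space = stream_space (measure_pmf (bernoulli_pmf (1/2)))"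

text \<open>
  The set below has at most one element (\<open>returns_deterministic\<close>) and is empty iff the computation does
  not halt, in which case its infimum is \<open>\<infinity>\<close>. The size of the result is charged for writing it out:
  a tree with shared subtrees can be exponentially larger than the number of steps spent to build it.
\<close>

definition run_time :: "algorithm \<Rightarrow> sexp \<Rightarrow> coins \<Rightarrow> ennreal" where
  "run_time A x \<omega> = Inf {of_nat (t + size v) | v t. returns A x \<omega> v t}"

definition expected_time :: "algorithm \<Rightarrow> sexp \<Rightarrow> ennreal" where
  "expected_time A x = (\<integral>\<^sup>+ \<omega>. run_time A x \<omega> \<partial>coin_space)"

definition expected_polytime_on :: "sexp set \<Rightarrow> algorithm \<Rightarrow> bool" where
  "expected_polytime_on X A \<longleftrightarrow>
    (\<exists>p :: nat poly. \<forall>x\<in>X. expected_time A x \<le> of_nat (poly p (size x)))"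


subsection \<open>Sanity of the cost model\<close>

lemma eval_deterministic:
  "eval D env e \<omega> v t \<omega>' \<Longrightarrow> eval D env e \<omega> v2 t2 \<omega>2 \<Longrightarrow> v = v2 \<and> t = t2 \<and> \<omega>' = \<omega>2"
  "evals D env es \<omega> vs t \<omega>' \<Longrightarrow> evals D env es \<omega> vs2 t2 \<omega>2 \<Longrightarrow> vs = vs2 \<and> t = t2 \<and> \<omega>' = \<omega>2"
proof (induction arbitrary: v2 t2 \<omega>2 and vs2 t2 \<omega>2 rule: eval_evals.inducts)
  case (Var i env \<omega>) from Var.prems show ?case by cases auto
next
  case (Leaf env \<omega>) from Leaf.prems show ?case by cases auto
next
  case (Node env e1 \<omega> v1 t1 \<omega>1 e2 w t \<omega>3) from Node.prems show ?case by cases (use Node.IH in blast)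
next
  case (Left env e \<omega> v t \<omega>1) from Left.prems show ?case by cases (use Left.IH in blast)
next
  case (Right env e \<omega> v t \<omega>1) from Right.prems show ?case by cases (use Right.IH in blast)
next
  case (If env b \<omega> v t \<omega>1 e1 e2 v' t' \<omega>3) from If.prems show ?case by cases (use If.IH in blast)
next
  case (Let env e1 \<omega> v1 t1 \<omega>1 e2 w t \<omega>3) from Let.prems show ?case by cases (use Let.IH in blast)
next
  case (Call env es \<omega> vs t \<omega>1 f v t' \<omega>3) from Call.prems show ?case by cases (use Call.IH in blast)
next
  case (Flip env \<omega>) from Flip.prems show ?case by cases auto
next
  case (Nil env \<omega>) from Nil.prems show ?case by cases auto
next
  case (Cons env e \<omega> v t \<omega>1 es vs t' \<omega>3) from Cons.prems show ?case by cases (use Cons.IH in blast)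
qed

lemma returns_deterministic:
  "returns A x \<omega> v t \<Longrightarrow> returns A x \<omega> v' t' \<Longrightarrow> v = v' \<and> t = t'"
  unfolding returns_def using eval_deterministic(1) by blast

lemma run_time_eq: "returns A x \<omega> v t \<Longrightarrow> run_time A x \<omega> = of_nat (t + size v)"
proof -
  assume r: "returns A x \<omega> v t"
  then have "{of_nat (t + size v) | v t. returns A x \<omega> v t} = {of_nat (t + size v) :: ennreal}"
    using returns_deterministic[OF r] by blast
  then show ?thesis by (simp add: run_time_def)
qed

lemma run_time_infinite_iff: "run_time A x \<omega> = \<infinity> \<longleftrightarrow> (\<nexists>v t. returns A x \<omega> v t)"
proof (cases "\<exists>v t. returns A x \<omega> v t")
  case True
  then obtain v t where "returns A x \<omega> v t" by blast
  from this run_time_eq[OF this] show ?thesis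
    by (metis ennreal_of_nat_neq_top infinity_ennreal_def)
next
  case False
  then have "{of_nat (t + size v) | v t. returns A x \<omega> v t} = ({} :: ennreal set)" by blast
  with False show ?thesis by (simp add: run_time_def)
qed

text \<open>A terminating evaluation depends on a finite prefix of the coins only.\<close>

lemma eval_prefix:
  "eval D env e \<omega> v t \<omega>' \<Longrightarrow> \<exists>bs. \<omega> = bs @- \<omega>' \<and> (\<forall>\<rho>. eval D env e (bs @- \<rho>) v t \<rho>)"
  "evals D env es \<omega> vs t \<omega>' \<Longrightarrow> \<exists>bs. \<omega> = bs @- \<omega>' \<and> (\<forall>\<rho>. evals D env es (bs @- \<rho>) vs t \<rho>)"
proof (induction rule: eval_evals.inducts)
  case (Var i env \<omega>)
  then show ?case by (intro exI[of _ "[]"]) (simp add: eval_evals.Var[simplified])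
next
  case (Leaf env \<omega>)
  then show ?case by (intro exI[of _ "[]"]) (simp add: eval_evals.Leaf[simplified])
next
  case (Node env e1 \<omega> v1 t1 \<omega>1 e2 w t \<omega>3)
  then obtain bs cs where "\<omega> = (bs @ cs) @- \<omega>3"
    "\<And>\<rho>. eval D env e1 (bs @- \<rho>) v1 t1 \<rho>" "\<And>\<rho>. eval D env e2 (cs @- \<rho>) w t \<rho>"
    by auto
  then show ?case by (intro exI[of _ "bs @ cs"]) (simp del: add_Suc_right One_nat_def, blast intro: eval_evals.Node)
next
  case (Left env e \<omega> v t \<omega>1)
  then show ?case by (blast intro: eval_evals.Left)
next
  case (Right env e \<omega> v t \<omega>1)
  then show ?case by (blast intro: eval_evals.Right)
next
  case (If env b \<omega> v t \<omega>1 e1 e2 v' t' \<omega>3)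
  from If.IH obtain bs cs where "\<omega> = (bs @ cs) @- \<omega>3"
    "\<And>\<rho>. eval D env b (bs @- \<rho>) v t \<rho>"
    "\<And>\<rho>. eval D env (if v \<noteq> Leaf then e1 else e2) (cs @- \<rho>) v' t' \<rho>"
    by (metis shift_append)
  then show ?case
    by (intro exI[of _ "bs @ cs"]) (metis eval_evals.If shift_append)
next
  case (Let env e1 \<omega> v1 t1 \<omega>1 e2 w t \<omega>3)
  then obtain bs cs where "\<omega> = (bs @ cs) @- \<omega>3"
    "\<And>\<rho>. eval D env e1 (bs @- \<rho>) v1 t1 \<rho>" "\<And>\<rho>. eval D (v1 # env) e2 (cs @- \<rho>) w t \<rho>"
    by auto
  then show ?case by (intro exI[of _ "bs @ cs"]) (metis eval_evals.Let shift_append)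
next
  case (Call env es \<omega> vs t \<omega>1 f v t' \<omega>3)
  then obtain bs cs where "\<omega> = (bs @ cs) @- \<omega>3"
    "\<And>\<rho>. evals D env es (bs @- \<rho>) vs t \<rho>" "\<And>\<rho>. eval D vs (D ! f) (cs @- \<rho>) v t' \<rho>"
    by auto
  with \<open>f < length D\<close> show ?case by (intro exI[of _ "bs @ cs"]) (metis eval_evals.Call shift_append)
next
  case (Flip env \<omega>)
  have "eval D env EFlip ([shd \<omega>] @- \<rho>) (if shd \<omega> then Node Leaf Leaf else Leaf) 1 \<rho>" for \<rho>
    using eval_evals.Flip[of D env "[shd \<omega>] @- \<rho>"] by simp
  then show ?case by (intro exI[of _ "[shd \<omega>]"]) simp
next
  case (Nil env \<omega>)
  then show ?case by (intro exI[of _ "[]"]) (simp add: eval_evals.Nil)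
next
  case (Cons env e \<omega> v t \<omega>1 es vs t' \<omega>3)
  then obtain bs cs where "\<omega> = (bs @ cs) @- \<omega>3"
    "\<And>\<rho>. eval D env e (bs @- \<rho>) v t \<rho>" "\<And>\<rho>. evals D env es (cs @- \<rho>) vs t' \<rho>"
    by auto
  then show ?case by (intro exI[of _ "bs @ cs"]) (metis eval_evals.Cons shift_append)
qed

lemma prob_space_coin_space: "prob_space coin_space"
  unfolding coin_space_def by (rule prob_space.prob_space_stream_space) (rule measure_pmf.prob_space_axioms)

lemma measurable_run_time: "run_time A x \<in> borel_measurable coin_space"
proof -
  define I where "I = {(bs, k). \<exists>v t. k = t + size v \<and> (\<forall>\<rho>. returns A x (bs @- \<rho>) v t)}"
  have "run_time A x \<omega> =
    (INF (bs, k)\<in>I. if stake (length bs) \<omega> = bs then of_nat k else \<infinity>)" (is "_ = ?R") for \<omega>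
  proof (rule antisym)
    show "run_time A x \<omega> \<le> ?R"
    proof (rule INF_greatest, clarsimp)
      fix bs k assume "(bs, k) \<in> I" and "stake (length bs) \<omega> = bs"
      moreover from this have "\<omega> = bs @- sdrop (length bs) \<omega>" by (metis stake_sdrop)
      ultimately show "run_time A x \<omega> \<le> of_nat k"
        unfolding I_def by (smt (verit) case_prodD mem_Collect_eq order_refl run_time_eq)
    qed
    show "?R \<le> run_time A x \<omega>"
    proof (cases "\<exists>v t. returns A x \<omega> v t")
      case True
      then obtain v t where r: "returns A x \<omega> v t" by blast
      then obtain bs \<omega>' where bs: "\<omega> = bs @- \<omega>'" "\<And>\<rho>. returns A x (bs @- \<rho>) v t"
        unfolding returns_def using eval_prefix(1) by meson
      then have "(bs, t + size v) \<in> I" by (auto simp: I_def)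
      moreover have "stake (length bs) \<omega> = bs" by (simp add: bs(1) stake_shift)
      ultimately show ?thesis
        unfolding run_time_eq[OF r] by (intro INF_lower2[of "(bs, t + size v)"]) auto
    next
      case False
      then have "run_time A x \<omega> = \<infinity>" by (simp add: run_time_infinite_iff del: infinity_ennreal_def)
      then show ?thesis by simp
    qed
  qed
  then have eq: "run_time A x =
    (\<lambda>\<omega>. INF i\<in>I. if stake (length (fst i)) \<omega> = fst i then of_nat (snd i) else \<infinity>)"
    by (auto simp: case_prod_beta')
  have [measurable]: "stake n \<in> measurable coin_space (count_space UNIV)" for n
  proof -
    have "sets coin_space = sets (stream_space (count_space (UNIV :: bool set)))"
      unfolding coin_space_def by (intro sets_stream_space_cong) simp
    then show ?thesis using measurable_stake measurable_cong_sets by blast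
  qed
  show ?thesis unfolding eq by (intro borel_measurable_INF) (auto intro: countableI_type)
qed

lemma AE_halts:
  assumes "expected_time A x < \<infinity>"
  shows "AE \<omega> in coin_space. \<exists>v t. returns A x \<omega> v t"
proof -
  have "AE \<omega> in coin_space. run_time A x \<omega> \<noteq> \<infinity>"
    using assms measurable_run_time unfolding expected_time_def
    by (intro nn_integral_PInf_AE) auto
  then show ?thesis by eventually_elim (simp add: run_time_infinite_iff del: infinity_ennreal_def)
qed


section \<open>Graphs and colorings\<close>

definition simple_graph :: "'a set \<Rightarrow> 'a set set \<Rightarrow> bool" where
  "simple_graph V E \<longleftrightarrow> finite V \<and> (\<forall>e\<in>E. e \<subseteq> V \<and> card e = 2)"

definition degree_in :: "'a set set \<Rightarrow> 'a \<Rightarrow> nat" where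
  "degree_in E v = card {e \<in> E. v \<in> e}"

definition max_degree_le :: "'a set \<Rightarrow> 'a set set \<Rightarrow> nat \<Rightarrow> bool" where
  "max_degree_le V E c \<longleftrightarrow> (\<forall>v\<in>V. degree_in E v \<le> c)"

definition proper_coloring :: "nat \<Rightarrow> 'a set \<Rightarrow> 'a set set \<Rightarrow> ('a \<Rightarrow> nat) \<Rightarrow> bool" where
  "proper_coloring k V E f \<longleftrightarrow> f \<in> V \<rightarrow> {..<k} \<and> (\<forall>u v. {u, v} \<in> E \<longrightarrow> f u \<noteq> f v)"

definition colorable :: "nat \<Rightarrow> 'a set \<Rightarrow> 'a set set \<Rightarrow> bool" where
  "colorable k V E \<longleftrightarrow> (\<exists>f. proper_coloring k V E f)"


section \<open>Binary Partial Coding Problem\<close>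

text \<open>
  An instance consists of the number \<open>d\<close> of attributes and the list of the symbols (two symbols
  at different positions may be the same set).
\<close>

type_synonym bpcp = "nat \<times> nat set list"

definition bpcp_instance :: "bpcp \<Rightarrow> bool" where
  "bpcp_instance = (\<lambda>(d, S). \<forall>s\<in>set S. s \<subseteq> {1..d})"

definition feasible_encoding :: "bpcp \<Rightarrow> (nat \<Rightarrow> nat \<Rightarrow> nat) \<Rightarrow> bool" where
  "feasible_encoding = (\<lambda>(d, S) c.
    (\<forall>j<length S. c j \<in> S ! j \<rightarrow>\<^sub>E {0, 1}) \<and>
    (\<forall>j<length S. \<forall>k<length S. j \<noteq> k \<longrightarrow> (\<exists>i\<in>S ! j \<inter> S ! k. c j i \<noteq> c k i)))"

definition bpcp_feasible :: "bpcp \<Rightarrow> bool" where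
  "bpcp_feasible P \<longleftrightarrow> (\<exists>c. feasible_encoding P c)"


section \<open>Inputs and outputs as trees\<close>

text \<open>
  Numbers are coded in unary. For a graph on the vertices \<open>0, \<dots>, n - 1\<close> this only
  affects the input size polynomially.
\<close>

fun code_nat :: "nat \<Rightarrow> sexp" where
  "code_nat 0 = Leaf"
| "code_nat (Suc n) = Node Leaf (code_nat n)"

fun code_list :: "('a \<Rightarrow> sexp) \<Rightarrow> 'a list \<Rightarrow> sexp" where
  "code_list f [] = Leaf"
| "code_list f (x # xs) = Node (f x) (code_list f xs)"

fun code_pair :: "('a \<Rightarrow> sexp) \<Rightarrow> ('b \<Rightarrow> sexp) \<Rightarrow> 'a \<times> 'b \<Rightarrow> sexp" where
  "code_pair f g (x, y) = Node (f x) (g y)"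

text \<open>Each edge is listed exactly once; order and orientation are arbitrary.\<close>

definition edge_list :: "(nat \<times> nat) list \<Rightarrow> nat set set \<Rightarrow> bool" where
  "edge_list es E \<longleftrightarrow>
    distinct (map (\<lambda>(u, v). {u, v}) es) \<and> set (map (\<lambda>(u, v). {u, v}) es) = E"

definition codes_graph :: "sexp \<Rightarrow> nat \<Rightarrow> nat set set \<Rightarrow> bool" where
  "codes_graph x n E \<longleftrightarrow> simple_graph {..<n} E \<and>
    (\<exists>es. edge_list es E \<and>
      x = code_pair code_nat (code_list (code_pair code_nat code_nat)) (n, es))"

text \<open>The attribute sets are listed in any order, possibly with repetitions.\<close>

definition codes_bpcp :: "sexp \<Rightarrow> bpcp \<Rightarrow> bool" where
  "codes_bpcp v = (\<lambda>(d, S). \<exists>ss. S = map set ss \<and>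
    v = code_pair code_nat (code_list (code_list code_nat)) (d, ss))"

end

theory Submission
  imports Defs
begin

text \<open>
  A deterministic reduction suffices, even with \<open>O(log n)\<close> attributes. Every vertex gets the
  attributes 1 and 2, whose four combinations are its color, and one extra symbol \<open>{1, 2}\<close> uses up
  the fourth combination. The remaining attributes must tell apart all non-adjacent pairs, whereas
  the vertices having a common one of them must be independent. For this, color the vertices greedily with
  \<open>c\<^sup>2 + c + 1\<close> auxiliary colors such that vertices at distance at most 2 get different ones. Between two
  color classes \<open>a\<close> and \<open>b\<close> the graph is then a matching. For every bit position \<open>t\<close> and bit \<open>\<beta>\<close>,
  the vertices of class \<open>a\<close> whose bit \<open>t\<close> is \<open>\<beta>\<close> and the vertices of class \<open>b\<close> for whose partner in
  class \<open>a\<close> (or for themselves, if they have none) it is not \<open>\<beta>\<close> are independent, and one attribute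
  separates the former from the latter. A non-adjacent pair is separated by a bit in which the first
  vertex differs from the partner of the second.

  The running time is bounded by closing the polynomial-time functions under composition and under
  list recursion whose steps enlarge the result only additively.
\<close>

section \<open>Polynomial-time functions\<close>

text \<open>A single power suffices because the base is at least 2: constant factors and sums are
  absorbed by a larger exponent. Monotonicity allows size estimates to be substituted into time
  bounds.\<close>

definition pbound :: "(nat \<Rightarrow> nat) \<Rightarrow> bool" where
  "pbound B \<longleftrightarrow> mono B \<and> (\<exists>k. \<forall>n. B n \<le> (n + 2) ^ k)"

lemma pboundE:
  assumes "pbound B"
  obtains k where "\<And>n. B n \<le> (n + 2) ^ k"
  using assms unfolding pbound_def by blast

lemma pbound_le: "pbound B \<Longrightarrow> m \<le> n \<Longrightarrow> B m \<le> B n"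
  unfolding pbound_def by (auto dest: monoD)

lemma pbound_const: "pbound (\<lambda>n. c)"
proof -
  \<comment> \<open>The constant is its own exponent, as c < 2^c.\<close>
  have "c \<le> (n + 2) ^ c" for n :: nat
    by (rule order_trans[OF less_imp_le[OF less_exp] power_mono]) auto
  then show ?thesis unfolding pbound_def mono_def by blast
qed

lemma pbound_id: "pbound (\<lambda>n. n)"
  unfolding pbound_def by (auto simp: mono_def intro!: exI[of _ 1])

lemma pbound_mult:
  assumes "pbound A" "pbound B"
  shows "pbound (\<lambda>n. A n * B n)"
proof -
  from assms obtain j k where jk: "\<And>n. A n \<le> (n + 2) ^ j" "\<And>n. B n \<le> (n + 2) ^ k"
    by (metis pboundE)
  have "A n * B n \<le> (n + 2) ^ (j + k)" for n
    unfolding power_add by (intro mult_mono jk) auto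
  moreover have "mono (\<lambda>n. A n * B n)"
    by (intro monoI mult_mono pbound_le[OF assms(1)] pbound_le[OF assms(2)]) auto
  ultimately show ?thesis unfolding pbound_def by blast
qed

lemma pbound_add:
  assumes "pbound A" "pbound B"
  shows "pbound (\<lambda>n. A n + B n)"
proof -
  from assms obtain j k where jk: "\<And>n. A n \<le> (n + 2) ^ j" "\<And>n. B n \<le> (n + 2) ^ k"
    by (metis pboundE)
  have "A n + B n \<le> (n + 2) ^ Suc (j + k)" for n
  proof -
    have "A n \<le> (n + 2) ^ (j + k)" "B n \<le> (n + 2) ^ (j + k)"
      using jk[of n] by (meson le_add1 le_add2 order_trans power_increasing one_le_numeral)+
    then have "A n + B n \<le> 2 * (n + 2) ^ (j + k)" by linarith
    also have "\<dots> \<le> (n + 2) * (n + 2) ^ (j + k)" by (rule mult_right_mono) auto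
    finally show ?thesis by simp
  qed
  moreover have "mono (\<lambda>n. A n + B n)"
    by (intro monoI add_mono pbound_le[OF assms(1)] pbound_le[OF assms(2)])
  ultimately show ?thesis unfolding pbound_def by blast
qed

lemma pbound_comp:
  assumes "pbound A" "pbound B"
  shows "pbound (\<lambda>n. A (B n))"
proof -
  from assms obtain j k where jk: "\<And>n. A n \<le> (n + 2) ^ j" "\<And>n. B n \<le> (n + 2) ^ k"
    by (metis pboundE)
  have "A (B n) \<le> (n + 2) ^ ((k + 2) * j)" for n
  proof -
    \<comment> \<open>With x = (n + 2)^k \<ge> 1, the argument x + 2 of the outer power is at most
      4x, and 4 is at most (n + 2)^2.\<close>
    have "1 \<le> (n + 2) ^ k" by simp
    moreover have "4 \<le> (n + 2) ^ 2" by (simp add: power2_eq_square)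
    ultimately have *: "(n + 2) ^ k + 2 \<le> (n + 2) ^ k * (n + 2) ^ 2"
      using mult_left_mono[of 4 "(n + 2) ^ 2" "(n + 2) ^ k"] by linarith
    have "B n + 2 \<le> (n + 2) ^ k + 2" using jk(2) by (rule add_right_mono)
    also note *
    also have "(n + 2) ^ k * (n + 2) ^ 2 = (n + 2) ^ (k + 2)" by (rule power_add[symmetric])
    finally have "(B n + 2) ^ j \<le> ((n + 2) ^ (k + 2)) ^ j" by (rule power_mono) (rule zero_le)
    also have "\<dots> = (n + 2) ^ ((k + 2) * j)" by (rule power_mult[symmetric])
    finally show ?thesis using jk(1) by (rule order_trans[rotated])
  qed
  moreover have "mono (\<lambda>n. A (B n))"
    by (intro monoI pbound_le[OF assms(1)] pbound_le[OF assms(2)])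
  ultimately show ?thesis unfolding pbound_def by blast
qed

lemmas pbound_intros = pbound_const pbound_id pbound_add pbound_mult

text \<open>The coin stream is the same before and after: the evaluation flips no coin, so value and
  time bound hold for all streams.\<close>

definition runs :: "expr list \<Rightarrow> sexp list \<Rightarrow> expr \<Rightarrow> sexp \<Rightarrow> nat \<Rightarrow> bool" where
  "runs D env e v B \<longleftrightarrow> (\<forall>\<omega>. \<exists>t\<le>B. eval D env e \<omega> v t \<omega>)"

definition calls :: "expr list \<Rightarrow> nat \<Rightarrow> sexp list \<Rightarrow> sexp \<Rightarrow> nat \<Rightarrow> bool" where
  "calls D i vs v B \<longleftrightarrow> i < length D \<and> runs D vs (D ! i) v B"

lemma runs_mono: "runs D env e v A \<Longrightarrow> A \<le> B \<Longrightarrow> runs D env e v B"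
  unfolding runs_def by (meson order_trans)

lemma calls_mono: "calls D i vs v A \<Longrightarrow> A \<le> B \<Longrightarrow> calls D i vs v B"
  unfolding calls_def using runs_mono by blast

section \<open>Step bounds for the forms of expressions\<close>

lemma runs_Var: "i < length env \<Longrightarrow> env ! i = v \<Longrightarrow> runs D env (EVar i) v 1"
  unfolding runs_def using eval_evals.Var by blast

lemma runs_Leaf: "runs D env ELeaf Leaf 1"
  unfolding runs_def using eval_evals.Leaf by blast

lemma runs_Node:
  assumes "runs D env e1 v1 B1" "runs D env e2 v2 B2"
  shows "runs D env (ENode e1 e2) (Node v1 v2) (B1 + B2 + 1)"
  unfolding runs_def
proof
  fix \<omega>
  from assms obtain t1 t2 where "t1 \<le> B1" "eval D env e1 \<omega> v1 t1 \<omega>" "t2 \<le> B2" "eval D env e2 \<omega> v2 t2 \<omega>"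
    unfolding runs_def by blast
  then show "\<exists>t\<le>B1 + B2 + 1. eval D env (ENode e1 e2) \<omega> (Node v1 v2) t \<omega>"
    by (intro exI[of _ "t1 + t2 + 1"] conjI eval_evals.Node) auto
qed

lemma runs_Left:
  assumes "runs D env e v B"
  shows "runs D env (ELeft e) (left v) (B + 1)"
  unfolding runs_def
proof
  fix \<omega>
  from assms obtain t where "t \<le> B" "eval D env e \<omega> v t \<omega>"
    unfolding runs_def by blast
  then show "\<exists>t\<le>B + 1. eval D env (ELeft e) \<omega> (left v) t \<omega>"
    by (intro exI[of _ "t + 1"] conjI eval_evals.Left) auto
qed

lemma runs_Right:
  assumes "runs D env e v B"
  shows "runs D env (ERight e) (right v) (B + 1)"
  unfolding runs_def
proof
  fix \<omega>
  from assms obtain t where "t \<le> B" "eval D env e \<omega> v t \<omega>"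
    unfolding runs_def by blast
  then show "\<exists>t\<le>B + 1. eval D env (ERight e) \<omega> (right v) t \<omega>"
    by (intro exI[of _ "t + 1"] conjI eval_evals.Right) auto
qed

lemma runs_If:
  assumes "runs D env b v B" "runs D env (if v \<noteq> Leaf then e1 else e2) v' B'"
  shows "runs D env (EIf b e1 e2) v' (B + B' + 1)"
  unfolding runs_def
proof
  fix \<omega>
  from assms obtain t t' where "t \<le> B" "eval D env b \<omega> v t \<omega>"
    "t' \<le> B'" "eval D env (if v \<noteq> Leaf then e1 else e2) \<omega> v' t' \<omega>"
    unfolding runs_def by blast
  then show "\<exists>t\<le>B + B' + 1. eval D env (EIf b e1 e2) \<omega> v' t \<omega>"
    by (intro exI[of _ "t + t' + 1"] conjI eval_evals.If) auto
qed

lemma runs_Call1: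
  assumes "runs D env e v B" "calls D i [v] w B'"
  shows "runs D env (ECall i [e]) w (B + B' + 1)"
  unfolding runs_def
proof
  fix \<omega>
  from assms obtain t t' where t: "t \<le> B" "eval D env e \<omega> v t \<omega>"
    and t': "t' \<le> B'" "i < length D" "eval D [v] (D ! i) \<omega> w t' \<omega>"
    unfolding runs_def calls_def by blast
  have "eval D env (ECall i [e]) \<omega> w (t + 0 + t' + 1) \<omega>"
    by (rule eval_evals.Call[OF eval_evals.Cons[OF t(2) eval_evals.Nil] t'(2,3)])
  then show "\<exists>t\<le>B + B' + 1. eval D env (ECall i [e]) \<omega> w t \<omega>"
    using t(1) t'(1) by (intro exI[of _ "t + 0 + t' + 1"]) auto
qed

lemma runs_Call2:
  assumes "runs D env e1 v1 B1" "runs D env e2 v2 B2" "calls D i [v1, v2] w B'"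
  shows "runs D env (ECall i [e1, e2]) w (B1 + B2 + B' + 1)"
  unfolding runs_def
proof
  fix \<omega>
  from assms obtain t1 t2 t' where t: "t1 \<le> B1" "eval D env e1 \<omega> v1 t1 \<omega>"
    "t2 \<le> B2" "eval D env e2 \<omega> v2 t2 \<omega>"
    and t': "t' \<le> B'" "i < length D" "eval D [v1, v2] (D ! i) \<omega> w t' \<omega>"
    unfolding runs_def calls_def by blast
  have "eval D env (ECall i [e1, e2]) \<omega> w (t1 + (t2 + 0) + t' + 1) \<omega>"
    by (rule eval_evals.Call[OF eval_evals.Cons[OF t(2) eval_evals.Cons[OF t(4) eval_evals.Nil]] t'(2,3)])
  then show "\<exists>t\<le>B1 + B2 + B' + 1. eval D env (ECall i [e1, e2]) \<omega> w t \<omega>"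
    using t(1,3) t'(1) by (intro exI[of _ "t1 + (t2 + 0) + t' + 1"]) auto
qed

section \<open>Data types coded as trees\<close>

class enc =
  fixes code :: "'a \<Rightarrow> sexp"

instantiation unit :: enc
begin
definition code_unit_def: "code (u :: unit) = Leaf"
instance ..
end

text \<open>This choice lets \<open>EIf\<close> branch directly on a coded truth value.\<close>

instantiation bool :: enc
begin
definition code_bool_def: "code b = (if b then Node Leaf Leaf else Leaf)"
instance ..
end

instantiation nat :: enc
begin
definition code_nat_def: "code = code_nat"
instance ..
end

instantiation prod :: (enc, enc) enc
begin
definition code_prod_def: "code = code_pair code code"
instance ..
end

instantiation list :: (enc) enc
begin
definition code_list_def: "code = code_list code"
instance ..
end

lemma code_simps [simp]:
  "code () = Leaf"
  "code True = Node Leaf Leaf" "code False = Leaf"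
  "code (0 :: nat) = Leaf" "code (Suc n) = Node Leaf (code n)"
  "code (x, y) = Node (code x) (code y)"
  "code [] = Leaf" "code (a # l) = Node (code a) (code l)"
  by (simp_all add: code_unit_def code_bool_def code_nat_def code_prod_def code_list_def)

abbreviation sz :: "'a::enc \<Rightarrow> nat" where "sz x \<equiv> size (code x)"

lemma sz_nat [simp]: "sz (n :: nat) = n"
  by (induction n) auto

lemma sz_bool_le: "sz (b :: bool) \<le> 1"
  by (cases b) auto

lemma sz_pair: "sz p = Suc (sz (fst p) + sz (snd p))"
  by (cases p) simp

text \<open>A unary number and a list of units are the same tree, so list recursion also provides
  recursion on numbers.\<close>

lemma code_replicate_unit: "code (replicate n ()) = code n"
  by (induction n) auto

lemma code_length_unit: "code (length (l :: unit list)) = code l"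
  by (induction l) auto

text \<open>
  The code \<open>F m\<close> of a function is relocatable: when it is placed at position \<open>m\<close> of the list of
  bodies, position \<open>m\<close> is its entry point. The size of the result is bounded separately, because
  sharing allows a short computation to build a huge tree.
\<close>

definition polytime :: "('a::enc \<Rightarrow> 'b::enc) \<Rightarrow> bool" where
  "polytime f \<longleftrightarrow> (\<exists>F B. pbound B \<and> (\<forall>x. sz (f x) \<le> B (sz x)) \<and>
    (\<forall>P Q x. calls (P @ F (length P) @ Q) (length P) [code x] (code (f x)) (B (sz x))))"

section \<open>Closure under constants, composition, pairing and conditionals\<close>

lemma polytimeI:
  assumes "pbound B" "pbound B'" "\<And>x. sz (f x) \<le> B (sz x)"
    and "\<And>P Q x. runs (P @ (e (length P) # F (length P)) @ Q) [code x] (e (length P)) (code (f x)) (B' (sz x))"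
  shows "polytime f"
  unfolding polytime_def
proof (intro exI conjI allI)
  show "pbound (\<lambda>n. B n + B' n)" using assms by (simp add: pbound_add)
  show "sz (f x) \<le> B (sz x) + B' (sz x)" for x using assms(3)[of x] by simp
  show "calls (P @ (\<lambda>n. e n # F n) (length P) @ Q) (length P) [code x] (code (f x)) (B (sz x) + B' (sz x))" for P Q x
    using runs_mono[OF assms(4)[of P Q x], of "B (sz x) + B' (sz x)"] by (simp add: calls_def)
qed

lemma polytimeE:
  assumes "polytime f"
  obtains F B where "pbound B" "\<And>x. sz (f x) \<le> B (sz x)"
    "\<And>P Q x. calls (P @ F (length P) @ Q) (length P) [code x] (code (f x)) (B (sz x))"
  using assms unfolding polytime_def by blast

lemma polytime_expr:
  assumes "\<And>x. sz (f x) \<le> sz x + c" "\<And>D x. runs D [code x] e (code (f x)) c"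
  shows "polytime f"
  by (rule polytimeI[where B = "\<lambda>n. n + c" and B' = "\<lambda>n. c" and e = "\<lambda>_. e" and F = "\<lambda>_. []"])
    (auto intro!: pbound_intros assms)

lemma polytime_cast: "(\<And>x. code (f x) = code x) \<Longrightarrow> polytime f"
  by (rule polytime_expr[where c = 1 and e = "EVar 0"]) (auto intro!: runs_Var[simplified])

lemma polytime_id: "polytime (\<lambda>x. x)"
  by (rule polytime_cast) simp

text \<open>The tree is spelled out as an expression. It has \<open>size s\<close> inner nodes and
  one leaf more, each costing one step.\<close>

lemma runs_constant: "\<exists>e. \<forall>D env. runs D env e s (2 * size s + 1)"
proof (induction s)
  case Leaf
  show ?case using runs_Leaf by fastforce
next
  case (Node a b)
  then obtain e1 e2 where "\<And>D env. runs D env e1 a (2 * size a + 1)" "\<And>D env. runs D env e2 b (2 * size b + 1)"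
    by blast
  then have "runs D env (ENode e1 e2) (Node a b) (2 * size a + 1 + (2 * size b + 1) + 1)" for D env
    by (intro runs_Node)
  then show ?case by (intro exI[of _ "ENode e1 e2"]) auto
qed

lemma polytime_const: "polytime (\<lambda>x. c)"
proof -
  obtain e where "\<And>D env. runs D env e (code c) (2 * sz c + 1)" using runs_constant by blast
  then show ?thesis by (intro polytime_expr[where e = e and c = "2 * sz c + 1"]) auto
qed

lemma polytime_comp:
  assumes "polytime g" "polytime f"
  shows "polytime (\<lambda>x. g (f x))"
proof -
  obtain F B where F: "pbound B" "\<And>x. sz (f x) \<le> B (sz x)"
    "\<And>P Q x. calls (P @ F (length P) @ Q) (length P) [code x] (code (f x)) (B (sz x))"
    using assms(2) by (rule polytimeE) blast
  obtain G C where G: "pbound C" "\<And>x. sz (g x) \<le> C (sz x)"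
    "\<And>P Q x. calls (P @ G (length P) @ Q) (length P) [code x] (code (g x)) (C (sz x))"
    using assms(1) by (rule polytimeE) blast
  \<comment> \<open>Layout from position m on: this body, then the code of f, then the code of g.
    The addresses of the two calls follow from the lengths.\<close>
  define e where "e m = ECall (m + 1 + length (F (m + 1))) [ECall (m + 1) [EVar 0]]" for m
  \<comment> \<open>The time of g depends on the size of its argument f x; this is where the bound
    on output sizes is used.\<close>
  have C: "C (sz (f x)) \<le> C (B (sz x))" for x by (rule pbound_le[OF G(1) F(2)])
  show ?thesis
  proof (rule polytimeI)
    show "pbound (\<lambda>n. C (B n))" by (rule pbound_comp[OF G(1) F(1)])
    then show "pbound (\<lambda>n. 1 + B n + 1 + C (B n) + 1)" by (intro pbound_intros F(1))
    show "sz (g (f x)) \<le> C (B (sz x))" for x using G(2) C by (rule order_trans)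
    fix P Q :: "expr list" and x
    let ?m = "length P"
    let ?D = "P @ (e ?m # F (?m + 1) @ G (?m + 1 + length (F (?m + 1)))) @ Q"
    have 1: "calls ?D (?m + 1) [code x] (code (f x)) (B (sz x))"
      using F(3)[of "P @ [e ?m]"] by simp
    have 2: "calls ?D (?m + 1 + length (F (?m + 1))) [code (f x)] (code (g (f x))) (C (B (sz x)))"
      using calls_mono[OF G(3)[of "P @ e ?m # F (?m + 1)" Q "f x"] C[of x]] by simp
    have "runs ?D [code x] (EVar 0) (code x) 1" by (rule runs_Var) auto
    from runs_Call1[OF runs_Call1[OF this 1] 2]
    show "runs ?D [code x] (e ?m) (code (g (f x))) (1 + B (sz x) + 1 + C (B (sz x)) + 1)"
      by (simp only: e_def)
  qed
qed

lemma polytime_Pair: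
  assumes "polytime f" "polytime g"
  shows "polytime (\<lambda>x. (f x, g x))"
proof -
  obtain F B where F: "pbound B" "\<And>x. sz (f x) \<le> B (sz x)"
    "\<And>P Q x. calls (P @ F (length P) @ Q) (length P) [code x] (code (f x)) (B (sz x))"
    using assms(1) by (rule polytimeE) blast
  obtain G C where G: "pbound C" "\<And>x. sz (g x) \<le> C (sz x)"
    "\<And>P Q x. calls (P @ G (length P) @ Q) (length P) [code x] (code (g x)) (C (sz x))"
    using assms(2) by (rule polytimeE) blast
  define e where "e m = ENode (ECall (m + 1) [EVar 0]) (ECall (m + 1 + length (F (m + 1))) [EVar 0])" for m
  show ?thesis
  proof (rule polytimeI)
    show "pbound (\<lambda>n. B n + C n + 1)" "pbound (\<lambda>n. (1 + B n + 1) + (1 + C n + 1) + 1)"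
      by (intro pbound_intros F(1) G(1))+
    show "sz (f x, g x) \<le> B (sz x) + C (sz x) + 1" for x using F(2)[of x] G(2)[of x] by simp
    fix P Q :: "expr list" and x
    let ?m = "length P"
    let ?D = "P @ (e ?m # F (?m + 1) @ G (?m + 1 + length (F (?m + 1)))) @ Q"
    have 1: "calls ?D (?m + 1) [code x] (code (f x)) (B (sz x))"
      using F(3)[of "P @ [e ?m]"] by simp
    have 2: "calls ?D (?m + 1 + length (F (?m + 1))) [code x] (code (g x)) (C (sz x))"
      using G(3)[of "P @ e ?m # F (?m + 1)" Q x] by (simp add: add.assoc)
    have "runs ?D [code x] (EVar 0) (code x) 1" by (rule runs_Var) auto
    from runs_Node[OF runs_Call1[OF this 1] runs_Call1[OF this 2]]
    show "runs ?D [code x] (e ?m) (code (f x, g x)) ((1 + B (sz x) + 1) + (1 + C (sz x) + 1) + 1)"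
      by (simp only: e_def code_simps)
  qed
qed

lemma polytime_If:
  assumes "polytime b" "polytime f" "polytime g"
  shows "polytime (\<lambda>x. if b x then f x else g x)"
proof -
  obtain E A where E: "pbound A" "\<And>x. sz (b x) \<le> A (sz x)"
    "\<And>P Q x. calls (P @ E (length P) @ Q) (length P) [code x] (code (b x)) (A (sz x))"
    using assms(1) by (rule polytimeE) blast
  obtain F B where F: "pbound B" "\<And>x. sz (f x) \<le> B (sz x)"
    "\<And>P Q x. calls (P @ F (length P) @ Q) (length P) [code x] (code (f x)) (B (sz x))"
    using assms(2) by (rule polytimeE) blast
  obtain G C where G: "pbound C" "\<And>x. sz (g x) \<le> C (sz x)"
    "\<And>P Q x. calls (P @ G (length P) @ Q) (length P) [code x] (code (g x)) (C (sz x))"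
    using assms(3) by (rule polytimeE) blast
  define p where "p m = m + 1 + length (E (m + 1))" for m
  define q where "q m = p m + length (F (p m))" for m
  define e where "e m = EIf (ECall (m + 1) [EVar 0]) (ECall (p m) [EVar 0]) (ECall (q m) [EVar 0])" for m
  show ?thesis
  proof (rule polytimeI)
    show "pbound (\<lambda>n. B n + C n)" "pbound (\<lambda>n. (1 + A n + 1) + (B n + C n + 2) + 1)"
      by (intro pbound_intros E(1) F(1) G(1))+
    show "sz (if b x then f x else g x) \<le> B (sz x) + C (sz x)" for x
      using F(2)[of x] G(2)[of x] by simp
    fix P Q :: "expr list" and x
    let ?m = "length P"
    let ?D = "P @ (e ?m # E (?m + 1) @ F (p ?m) @ G (q ?m)) @ Q"
    have 1: "calls ?D (?m + 1) [code x] (code (b x)) (A (sz x))"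
      using E(3)[of "P @ [e ?m]"] by simp
    have 2: "calls ?D (p ?m) [code x] (code (f x)) (B (sz x))"
      using F(3)[of "P @ e ?m # E (?m + 1)" "G (q ?m) @ Q" x] by (simp add: p_def add.assoc)
    have 3: "calls ?D (q ?m) [code x] (code (g x)) (C (sz x))"
      using G(3)[of "P @ e ?m # E (?m + 1) @ F (p ?m)" Q x] by (simp add: p_def q_def add.assoc)
    have V: "runs ?D [code x] (EVar 0) (code x) 1" by (rule runs_Var) auto
    have "runs ?D [code x] (if code (b x) \<noteq> Leaf then ECall (p ?m) [EVar 0] else ECall (q ?m) [EVar 0])
      (code (if b x then f x else g x)) (B (sz x) + C (sz x) + 2)"
      using runs_mono[OF runs_Call1[OF V 2], of "B (sz x) + C (sz x) + 2"]
        runs_mono[OF runs_Call1[OF V 3], of "B (sz x) + C (sz x) + 2"] by simp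
    from runs_If[OF runs_Call1[OF V 1] this]
    show "runs ?D [code x] (e ?m) (code (if b x then f x else g x))
      ((1 + A (sz x) + 1) + (B (sz x) + C (sz x) + 2) + 1)"
      by (simp only: e_def)
  qed
qed

section \<open>Recursion over lists\<close>

lemma length_le_sz: "length l \<le> sz l"
  by (induction l) auto

text \<open>Each of the \<open>length l\<close> rounds adds at most \<open>B m\<close>, because
  every element and tail is no larger than the list. Growth by a factor per round could instead
  become exponential.\<close>

lemma sz_rec_list_le:
  assumes "pbound B" "\<And>a t r. sz (h a t r) \<le> sz r + B (n + sz a + sz t)" "n + sz l \<le> m"
  shows "sz (rec_list g h l) \<le> sz g + length l * B m"
  using assms(3)
proof (induction l)
  case (Cons a t)
  have "B (n + sz a + sz t) \<le> B m" by (rule pbound_le[OF assms(1)]) (use Cons.prems in simp)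
  with Cons.IH Cons.prems assms(2)[of a t "rec_list g h t"] show ?case by simp
qed simp

lemma runs_If_Leaf:
  "runs D env b Leaf B \<Longrightarrow> runs D env e2 v B' \<Longrightarrow> runs D env (EIf b e1 e2) v (B + B' + 1)"
  by (rule runs_If) auto

lemma runs_If_Node:
  "runs D env b (Node l r) B \<Longrightarrow> runs D env e1 v B' \<Longrightarrow> runs D env (EIf b e1 e2) v (B + B' + 1)"
  by (rule runs_If) auto

lemma polytime_rec_list_pair:
  fixes g :: "'a::enc \<Rightarrow> 'r::enc" and h :: "'a \<Rightarrow> 'b::enc \<Rightarrow> 'b list \<Rightarrow> 'r \<Rightarrow> 'r"
  assumes "polytime g"
    and "polytime (\<lambda>z. h (fst z) (fst (snd z)) (fst (snd (snd z))) (snd (snd (snd z))))"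
    and "pbound B" "\<And>x a t r. sz (h x a t r) \<le> sz r + B (sz x + sz a + sz t)"
  shows "polytime (\<lambda>p. rec_list (g (fst p)) (h (fst p)) (snd p))"
proof -
  obtain G Bg where G: "pbound Bg" "\<And>x. sz (g x) \<le> Bg (sz x)"
    "\<And>P Q x. calls (P @ G (length P) @ Q) (length P) [code x] (code (g x)) (Bg (sz x))"
    using assms(1) by (rule polytimeE) blast
  obtain H Bh where H: "pbound Bh"
    "\<And>P Q z. calls (P @ H (length P) @ Q) (length P) [code z]
      (code (h (fst z) (fst (snd z)) (fst (snd (snd z))) (snd (snd (snd z))))) (Bh (sz z))"
    using assms(2) by (rule polytimeE) blast
  \<comment> \<open>\<open>A\<close> bounds all intermediate results and \<open>C\<close> the cost
    of one round. The argument of h has three pair nodes, whence s + A s + 3; the 20 exceeds the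
    fixed overhead of a round.\<close>
  define A where "A s = Bg s + s * B s" for s
  define C where "C s = Bg s + Bh (s + A s + 3) + 20" for s
  have A: "pbound A" unfolding A_def by (intro pbound_intros G(1) assms(3))
  have C: "pbound C" unfolding C_def by (intro pbound_intros G(1) A pbound_comp[OF H(1)])
  have rec_le: "sz (rec_list (g x) (h x) l) \<le> A s" if "sz x + sz l \<le> s" for x l s
  proof -
    have "sz (rec_list (g x) (h x) l) \<le> sz (g x) + length l * B s"
      using assms(3) that by (intro sz_rec_list_le[where n = "sz x"] assms(4)) auto
    also have "\<dots> \<le> Bg s + s * B s"
      using that length_le_sz[of l]
      by (intro add_mono mult_right_mono order_trans[OF G(2) pbound_le[OF G(1)]]) auto
    finally show ?thesis unfolding A_def .
  qed
  define p where "p m = m + 2 + length (G (m + 2))" for m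
  \<comment> \<open>The bodies are the entry point, this loop, the code of g and the code of h.
    Variable 0 is the parameter and variable 1 the list, which is \<open>Leaf\<close> exactly when
    empty.\<close>
  define loop where "loop m = EIf (EVar 1)
    (ECall (p m) [ENode (EVar 0) (ENode (ELeft (EVar 1)) (ENode (ERight (EVar 1))
      (ECall (m + 1) [EVar 0, ERight (EVar 1)])))])
    (ECall (m + 2) [EVar 0])" for m
  define e where "e m = ECall (m + 1) [ELeft (EVar 0), ERight (EVar 0)]" for m :: nat
  show ?thesis
  proof (rule polytimeI)
    show "pbound A" by (rule A)
    show "pbound (\<lambda>n. (1 + 1) + (1 + 1) + (n + 1) * C n + 1)" by (intro pbound_intros C)
    show "sz (rec_list (g (fst p)) (h (fst p)) (snd p)) \<le> A (sz p)" for p :: "'a \<times> 'b list"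
      by (rule rec_le) (simp add: sz_pair)
    fix P Q :: "expr list" and y :: "'a \<times> 'b list"
    let ?m = "length P"
    let ?D = "P @ (e ?m # loop ?m # G (?m + 2) @ H (p ?m)) @ Q"
    obtain x l where y: "y = (x, l)" by (cases y)
    have 1: "calls ?D (?m + 2) [code x] (code (g x)) (Bg (sz x))" for x
      using G(3)[of "P @ [e ?m, loop ?m]"] by simp
    have 2: "calls ?D (p ?m) [code (x, a, t, r)] (code (h x a t r)) (Bh (sz (x, a, t, r)))" for x a t r
      using H(2)[of "P @ e ?m # loop ?m # G (?m + 2)" Q "(x, a, t, r)"] by (simp add: p_def)
    \<comment> \<open>The bound s stays fixed during the induction, so that all rounds are charged
      the same \<open>C s\<close>; the extra \<open>C s\<close> pays for the empty list.\<close>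
    have loop: "calls ?D (?m + 1) [code x, code l] (code (rec_list (g x) (h x) l)) (length l * C s + C s)"
      if "sz x + sz l \<le> s" for x l s
      using that
    proof (induction l)
      case Nil
      have V: "runs ?D [code x, code ([] :: 'b list)] (EVar 0) (code x) 1"
        "runs ?D [code x, code ([] :: 'b list)] (EVar 1) Leaf 1" by (auto intro: runs_Var[simplified])
      from runs_If_Leaf[OF V(2) runs_Call1[OF V(1) 1]]
      have "runs ?D [code x, code ([] :: 'b list)] (loop ?m) (code (g x)) (1 + (1 + Bg (sz x) + 1) + 1)"
        by (simp only: loop_def)
      moreover have "Bg (sz x) \<le> Bg s" by (rule pbound_le[OF G(1)]) (use Nil in simp)
      ultimately show ?case
        unfolding calls_def by (auto simp: nth_append C_def elim!: runs_mono)
    next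
      case (Cons a t)
      let ?env = "[code x, code (a # t)]" and ?r = "rec_list (g x) (h x) t"
      have V: "runs ?D ?env (EVar 0) (code x) 1" "runs ?D ?env (EVar 1) (Node (code a) (code t)) 1"
        by (auto intro: runs_Var[simplified])
      have L: "runs ?D ?env (ELeft (EVar 1)) (code a) (1 + 1)" using runs_Left[OF V(2)] by simp
      have R: "runs ?D ?env (ERight (EVar 1)) (code t) (1 + 1)" using runs_Right[OF V(2)] by simp
      have "sz x + sz t \<le> s" using Cons.prems by simp
      from Cons.IH[OF this] have IH: "calls ?D (?m + 1) [code x, code t] (code ?r) (length t * C s + C s)" .
      from runs_Node[OF V(1) runs_Node[OF L runs_Node[OF R runs_Call2[OF V(1) R IH]]]]
      have "runs ?D ?env (ENode (EVar 0) (ENode (ELeft (EVar 1)) (ENode (ERight (EVar 1))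
          (ECall (?m + 1) [EVar 0, ERight (EVar 1)])))) (code (x, a, t, ?r))
        (1 + ((1 + 1) + ((1 + 1) + (1 + (1 + 1) + (length t * C s + C s) + 1) + 1) + 1) + 1)"
        by (simp only: code_simps)
      from runs_If_Node[OF V(2) runs_Call1[OF this 2]]
      have "runs ?D ?env (loop ?m) (code (h x a t ?r))
        (1 + (1 + ((1 + 1) + ((1 + 1) + (1 + (1 + 1) + (length t * C s + C s) + 1) + 1) + 1) + 1 + Bh (sz (x, a, t, ?r)) + 1) + 1)"
        by (simp only: loop_def)
      moreover have "Bh (sz (x, a, t, ?r)) \<le> Bh (s + A s + 3)"
        by (rule pbound_le[OF H(1)]) (use Cons.prems rec_le[of x t s] in simp)
      ultimately show ?case
        unfolding calls_def by (auto simp: nth_append C_def elim!: runs_mono)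
    qed
    have V: "runs ?D [code y] (EVar 0) (code y) 1" by (rule runs_Var) auto
    have L: "runs ?D [code y] (ELeft (EVar 0)) (code x) (1 + 1)" using runs_Left[OF V] by (simp add: y)
    have R: "runs ?D [code y] (ERight (EVar 0)) (code l) (1 + 1)" using runs_Right[OF V] by (simp add: y)
    have "sz x + sz l \<le> sz y" by (simp add: y)
    from runs_Call2[OF L R loop[OF this]]
    have "runs ?D [code y] (e ?m) (code (rec_list (g x) (h x) l))
      ((1 + 1) + (1 + 1) + (length l * C (sz y) + C (sz y)) + 1)"
      by (simp only: e_def)
    moreover have "length l \<le> sz y" using length_le_sz[of l] by (simp add: y)
    then have "length l * C (sz y) + C (sz y) \<le> (sz y + 1) * C (sz y)" by simp
    ultimately show "runs ?D [code y] (e ?m) (code (rec_list (g (fst y)) (h (fst y)) (snd y)))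
      ((1 + 1) + (1 + 1) + (sz y + 1) * C (sz y) + 1)"
      by (simp only: y fst_conv snd_conv) (erule runs_mono, simp)
  qed
qed

section \<open>A library of functions on pairs, lists and numbers\<close>

lemma polytime_comp2:
  "polytime (\<lambda>p. F (fst p) (snd p)) \<Longrightarrow> polytime f \<Longrightarrow> polytime g \<Longrightarrow> polytime (\<lambda>x. F (f x) (g x))"
  using polytime_comp[OF _ polytime_Pair, of "\<lambda>p. F (fst p) (snd p)" f g] by simp

lemma polytime_comp3:
  assumes "polytime (\<lambda>p. F (fst p) (fst (snd p)) (snd (snd p)))" "polytime f" "polytime g" "polytime h"
  shows "polytime (\<lambda>x. F (f x) (g x) (h x))"
  using polytime_comp[OF assms(1) polytime_Pair[OF assms(2) polytime_Pair[OF assms(3,4)]]] by simp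

lemma polytime_comp4:
  assumes "polytime (\<lambda>p. F (fst p) (fst (snd p)) (fst (snd (snd p))) (snd (snd (snd p))))"
    and "polytime f" "polytime g" "polytime h" "polytime i"
  shows "polytime (\<lambda>x. F (f x) (g x) (h x) (i x))"
  using polytime_comp3[where F = "\<lambda>a b p. F a b (fst p) (snd p)", OF assms(1-3) polytime_Pair[OF assms(4,5)]]
  by simp

lemma polytime_rec_list:
  fixes g :: "'a::enc \<Rightarrow> 'r::enc" and h :: "'a \<Rightarrow> 'b::enc \<Rightarrow> 'b list \<Rightarrow> 'r \<Rightarrow> 'r"
  assumes "polytime l" "polytime g"
    and "polytime (\<lambda>z. h (fst z) (fst (snd z)) (fst (snd (snd z))) (snd (snd (snd z))))"
    and "pbound B" "\<And>x a t r. sz (h x a t r) \<le> sz r + B (sz x + sz a + sz t)"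
  shows "polytime (\<lambda>x. rec_list (g x) (h x) (l x))"
proof -
  have "polytime (\<lambda>p. rec_list (g (fst p)) (h (fst p)) (snd p))"
    by (rule polytime_rec_list_pair[where B = B]) (fact assms)+
  from polytime_comp[OF this polytime_Pair[OF polytime_id assms(1)]] show ?thesis by simp
qed

lemma code_pair_eq: "code p = Node (code (fst p)) (code (snd p))"
  by (cases p) simp

lemma polytime_fst_prim: "polytime fst"
proof (rule polytime_expr[where c = "1 + 1"])
  fix D and x :: "'a \<times> 'b"
  have "runs D [code x] (EVar 0) (Node (code (fst x)) (code (snd x))) 1"
    unfolding code_pair_eq[symmetric] by (rule runs_Var) auto
  from runs_Left[OF this] show "runs D [code x] (ELeft (EVar 0)) (code (fst x)) (1 + 1)" by simp
qed (simp add: sz_pair)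

lemma polytime_snd_prim: "polytime snd"
proof (rule polytime_expr[where c = "1 + 1"])
  fix D and x :: "'a \<times> 'b"
  have "runs D [code x] (EVar 0) (Node (code (fst x)) (code (snd x))) 1"
    unfolding code_pair_eq[symmetric] by (rule runs_Var) auto
  from runs_Right[OF this] show "runs D [code x] (ERight (EVar 0)) (code (snd x)) (1 + 1)" by simp
qed (simp add: sz_pair)

lemmas polytime_fst = polytime_comp[OF polytime_fst_prim]
lemmas polytime_snd = polytime_comp[OF polytime_snd_prim]

text \<open>A nonempty list has the same tree as the pair of its head and tail. Likewise a successor
  below has the tree of a pair with first component \<open>()\<close>.\<close>

lemma polytime_Cons: "polytime f \<Longrightarrow> polytime g \<Longrightarrow> polytime (\<lambda>x. f x # g x)"
  by (rule polytime_comp2[where F = "(#)", OF polytime_cast]) (simp add: code_pair_eq)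

lemma polytime_Suc: "polytime f \<Longrightarrow> polytime (\<lambda>x. Suc (f x))"
  by (rule polytime_comp2[where F = "\<lambda>u. Suc", OF polytime_cast polytime_const[of "()"]]) (simp add: code_pair_eq)

lemma polytime_pred: "polytime f \<Longrightarrow> polytime (\<lambda>x. f x - Suc 0)"
proof (erule polytime_comp[rotated], rule polytime_expr[where c = "1 + 1"])
  fix D and n :: nat
  have "runs D [code n] (EVar 0) (code n) 1" by (rule runs_Var) auto
  from runs_Right[OF this] show "runs D [code n] (ERight (EVar 0)) (code (n - Suc 0)) (1 + 1)" by (cases n) auto
qed simp

lemma polytime_eq_0: "polytime f \<Longrightarrow> polytime (\<lambda>x. f x = (0 :: nat))"
proof (erule polytime_comp[rotated], rule polytime_expr[where c = "1 + (1 + 1 + 1) + 1"])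
  fix D and n :: nat
  have V: "runs D [code n] (EVar 0) (code n) 1" by (rule runs_Var) auto
  show "runs D [code n] (EIf (EVar 0) ELeaf (ENode ELeaf ELeaf)) (code (n = 0)) (1 + (1 + 1 + 1) + 1)"
  proof (cases n)
    case 0
    show ?thesis using runs_If_Leaf[OF V[unfolded 0 code_simps] runs_Node[OF runs_Leaf runs_Leaf]] 0 by simp
  next
    case (Suc m)
    show ?thesis
      using runs_mono[OF runs_If_Node[OF V[unfolded Suc code_simps] runs_Leaf], of "1 + (1 + 1 + 1) + 1"] Suc by simp
  qed
  show "sz (n = 0) \<le> sz n + (1 + (1 + 1 + 1) + 1)" using sz_bool_le[of "n = 0"] by linarith
qed

lemma polytime_conj: "polytime f \<Longrightarrow> polytime g \<Longrightarrow> polytime (\<lambda>x. f x \<and> g x)"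
  using polytime_If[of f g "\<lambda>x. False"] by (simp add: polytime_const if_bool_eq_disj)

lemma polytime_disj: "polytime f \<Longrightarrow> polytime g \<Longrightarrow> polytime (\<lambda>x. f x \<or> g x)"
  using polytime_If[of f "\<lambda>x. True" g] by (simp add: polytime_const if_bool_eq_conj disj_imp)

lemma polytime_Not: "polytime f \<Longrightarrow> polytime (\<lambda>x. \<not> f x)"
  using polytime_If[of f "\<lambda>x. False" "\<lambda>x. True"] by (simp add: polytime_const if_bool_eq_disj)

lemma polytime_map:
  fixes l :: "'a::enc \<Rightarrow> 'b::enc list" and f :: "'a \<Rightarrow> 'b \<Rightarrow> 'c::enc"
  assumes "polytime l" "polytime (\<lambda>z. f (fst z) (snd z))"
  shows "polytime (\<lambda>x. map (f x) (l x))"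
proof -
  obtain B where B: "pbound B" "\<And>z. sz (f (fst z) (snd z)) \<le> B (sz z)"
    using assms(2) by (rule polytimeE) blast
  have map: "map g l = rec_list [] (\<lambda>a t r. g a # r) l" for g :: "'b \<Rightarrow> 'c" and l
    by (induction l) auto
  show ?thesis unfolding map
  proof (rule polytime_rec_list[where B = "\<lambda>n. B (n + 1) + 1"])
    show "sz (f x a # r) \<le> sz r + (B (sz x + sz a + sz t + 1) + 1)" for x a r and t :: "'b list"
      using order_trans[OF B(2)[of "(x, a)"] pbound_le[OF B(1), of _ "sz x + sz a + sz t + 1"]] by simp
    show "polytime (\<lambda>z. f (fst z) (fst (snd z)) # snd (snd (snd z)))"
      by (intro polytime_Cons polytime_comp2[OF assms(2)] polytime_fst polytime_snd polytime_id)
  qed (intro assms(1) polytime_const pbound_intros pbound_comp[OF B(1)])+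
qed

lemma polytime_filter:
  fixes l :: "'a::enc \<Rightarrow> 'b::enc list"
  assumes "polytime l" "polytime (\<lambda>z. P (fst z) (snd z))"
  shows "polytime (\<lambda>x. filter (P x) (l x))"
proof -
  have filter: "filter P l = rec_list [] (\<lambda>a t r. if P a then a # r else r) l" for P :: "'b \<Rightarrow> bool" and l
    by (induction l) auto
  show ?thesis unfolding filter
  proof (rule polytime_rec_list[where B = "\<lambda>n. n + 1"])
    show "polytime (\<lambda>z. if P (fst z) (fst (snd z)) then fst (snd z) # snd (snd (snd z)) else snd (snd (snd z)))"
      by (intro polytime_If polytime_Cons polytime_comp2[OF assms(2)] polytime_fst polytime_snd polytime_id)
  qed (intro assms(1) polytime_const pbound_intros | simp)+
qed

lemma polytime_Bex:
  fixes l :: "'a::enc \<Rightarrow> 'b::enc list"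
  assumes "polytime l" "polytime (\<lambda>z. P (fst z) (snd z))"
  shows "polytime (\<lambda>x. \<exists>a\<in>set (l x). P x a)"
proof -
  have ex: "(\<exists>a\<in>set l. P a) = rec_list False (\<lambda>a t r. P a \<or> r) l" for P :: "'b \<Rightarrow> bool" and l
    by (induction l) auto
  show ?thesis unfolding ex
  proof (rule polytime_rec_list[where B = "\<lambda>n. 1"])
    show "polytime (\<lambda>z. P (fst z) (fst (snd z)) \<or> snd (snd (snd z)))"
      by (intro polytime_disj polytime_comp2[OF assms(2)] polytime_fst polytime_snd polytime_id)
  qed (intro assms(1) polytime_const pbound_intros trans_le_add2 sz_bool_le)+
qed

text \<open>Linear search phrased as list recursion, so that \<open>polytime_rec_list\<close>
  applies; the default \<open>d\<close> makes it total.\<close>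

definition first :: "('a \<Rightarrow> bool) \<Rightarrow> 'a list \<Rightarrow> 'a \<Rightarrow> 'a" where
  "first P l d = rec_list d (\<lambda>a t r. if P a then a else r) l"

lemma first_exists: "a \<in> set l \<Longrightarrow> P a \<Longrightarrow> first P l d \<in> set l \<and> P (first P l d)"
  unfolding first_def by (induction l) auto

lemma first_default: "\<forall>a\<in>set l. \<not> P a \<Longrightarrow> first P l d = d"
  unfolding first_def by (induction l) auto

lemma polytime_first:
  assumes "polytime l" "polytime (\<lambda>z. P (fst z) (snd z))" "polytime d"
  shows "polytime (\<lambda>x. first (P x) (l x) (d x))"
  unfolding first_def
proof (rule polytime_rec_list[where B = "\<lambda>n. n"])
  show "polytime (\<lambda>z. if P (fst z) (fst (snd z)) then fst (snd z) else snd (snd (snd z)))"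
    by (intro polytime_If polytime_comp2[OF assms(2)] polytime_fst polytime_snd polytime_id)
qed (intro assms pbound_intros | simp)+

lemma polytime_replicate_unit: "polytime n \<Longrightarrow> polytime (\<lambda>x. replicate (n x) ())"
  by (rule polytime_comp[OF polytime_cast]) (simp_all add: code_replicate_unit)

lemma polytime_length:
  fixes l :: "'a::enc \<Rightarrow> 'b::enc list"
  assumes "polytime l"
  shows "polytime (\<lambda>x. length (l x))"
proof -
  have length: "length l = rec_list 0 (\<lambda>a t r. Suc r) l" for l :: "'b list"
    by (induction l) auto
  show ?thesis unfolding length
    by (rule polytime_rec_list[where B = "\<lambda>n. 1"])
      (intro assms polytime_const pbound_intros polytime_Suc polytime_snd polytime_id | simp)+
qed

lemma polytime_funpow:
  fixes s :: "'a::enc \<Rightarrow> 'b::enc \<Rightarrow> 'b"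
  assumes "polytime n" "polytime i" "polytime (\<lambda>z. s (fst z) (snd z))"
    and "pbound B" "\<And>x r. sz (s x r) \<le> sz r + B (sz x)"
  shows "polytime (\<lambda>x. (s x ^^ n x) (i x))"
proof -
  have funpow: "(f ^^ n) i = rec_list i (\<lambda>a t r. f r) (replicate n ())" for f :: "'b \<Rightarrow> 'b" and n i
    by (induction n) auto
  show ?thesis unfolding funpow
  proof (rule polytime_rec_list[where B = B])
    show "polytime (\<lambda>z. s (fst z) (snd (snd (snd z))))"
      by (intro polytime_comp2[OF assms(3)] polytime_fst polytime_snd polytime_id)
    show "sz (s x r) \<le> sz r + B (sz x + sz a + sz t)" for x r and a :: unit and t :: "unit list"
      using assms(5)[of x r] pbound_le[OF assms(4), of "sz x" "sz x + sz a + sz t"] by simp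
  qed (intro assms polytime_replicate_unit)+
qed

text \<open>The descending order fits list recursion: in a list of n + 1 units the tail has length
  n, which is the next entry.\<close>

definition down :: "nat \<Rightarrow> nat list" where
  "down n = rev [0..<n]"

lemma down_Suc: "down (Suc n) = n # down n"
  by (simp add: down_def)

lemma set_down [simp]: "set (down n) = {..<n}"
  by (auto simp: down_def)

lemma distinct_down [simp]: "distinct (down n)"
  by (simp add: down_def)

lemma length_down [simp]: "length (down n) = n"
  by (simp add: down_def)

lemma polytime_down: "polytime n \<Longrightarrow> polytime (\<lambda>x. down (n x))"
proof -
  assume n: "polytime n"
  have down: "down n = rec_list [] (\<lambda>a t r. length t # r) (replicate n ())" for n
    by (induction n) (auto simp: down_Suc, simp add: down_def)
  show ?thesis unfolding down
  proof (rule polytime_rec_list[where B = "\<lambda>n. n + 1"])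
    show "sz (length t # r) \<le> sz r + (sz x + sz a + sz t + 1)" for x r and a :: unit and t :: "unit list"
      using code_length_unit[of t] by simp
  qed (intro n polytime_const pbound_intros polytime_replicate_unit polytime_Cons polytime_length
      polytime_fst polytime_snd polytime_id)+
qed

lemma polytime_add: "polytime f \<Longrightarrow> polytime g \<Longrightarrow> polytime (\<lambda>x. f x + g x :: nat)"
proof -
  assume fg: "polytime f" "polytime g"
  have add: "m + n = (Suc ^^ n) m" for m n
    by (induction n) auto
  show ?thesis unfolding add
    by (rule polytime_funpow[where B = "\<lambda>n. 1"])
      (intro fg pbound_intros polytime_Suc polytime_snd polytime_id | simp)+
qed

lemma polytime_diff: "polytime f \<Longrightarrow> polytime g \<Longrightarrow> polytime (\<lambda>x. f x - g x :: nat)"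
proof -
  assume fg: "polytime f" "polytime g"
  have diff: "m - n = ((\<lambda>r. r - Suc 0) ^^ n) m" for m n :: nat
    by (induction n) auto
  have "(\<lambda>x. f x - g x) = (\<lambda>x. ((\<lambda>r. r - Suc 0) ^^ g x) (f x))"
    by (intro ext diff)
  moreover have "polytime \<dots>"
    by (rule polytime_funpow[where B = "\<lambda>n. 0"])
      (intro fg pbound_intros polytime_pred polytime_snd polytime_id | simp)+
  ultimately show ?thesis by (simp only:)
qed

lemma polytime_mult: "polytime f \<Longrightarrow> polytime g \<Longrightarrow> polytime (\<lambda>x. f x * g x :: nat)"
proof (rule polytime_comp2[where F = "(*)"])
  have mult: "m * n = (((+) m) ^^ n) 0" for m n :: nat
    by (induction n) auto
  show "polytime (\<lambda>p. fst p * snd p :: nat)" unfolding mult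
    by (rule polytime_funpow[where B = "\<lambda>n. n"])
      (intro pbound_intros polytime_add polytime_const polytime_fst polytime_snd polytime_id | simp add: sz_pair)+
qed

lemma polytime_eq: "polytime f \<Longrightarrow> polytime g \<Longrightarrow> polytime (\<lambda>x. f x = (g x :: nat))"
proof -
  assume fg: "polytime f" "polytime g"
  have "polytime (\<lambda>x. f x - g x = 0 \<and> g x - f x = 0)"
    by (intro polytime_conj polytime_eq_0 polytime_diff fg)
  also have "(\<lambda>x. f x - g x = 0 \<and> g x - f x = 0) = (\<lambda>x. f x = g x)"
    by auto
  finally show ?thesis .
qed

lemma polytime_less: "polytime f \<Longrightarrow> polytime g \<Longrightarrow> polytime (\<lambda>x. f x < (g x :: nat))"
proof -
  assume fg: "polytime f" "polytime g"
  have less: "m < n \<longleftrightarrow> \<not> n - m = 0" for m n :: nat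
    by auto
  show ?thesis unfolding less by (intro polytime_Not polytime_eq_0 polytime_diff fg)
qed

text \<open>Counting up with a carry from remainder to quotient. For m = 0 no carry occurs, in
  accordance with n div 0 = 0 and n mod 0 = n.\<close>

definition divmod_step :: "nat \<Rightarrow> nat \<times> nat \<Rightarrow> nat \<times> nat" where
  "divmod_step m p = (if Suc (snd p) = m then (Suc (fst p), 0) else (fst p, Suc (snd p)))"

lemma funpow_divmod_step: "(divmod_step m ^^ n) (0, 0) = (n div m, n mod m)"
  by (induction n) (auto simp: divmod_step_def div_Suc mod_Suc)

lemma polytime_divmod: "polytime (\<lambda>p. (fst p div snd p, fst p mod snd p :: nat))"
  unfolding funpow_divmod_step[symmetric]
proof (rule polytime_funpow[where B = "\<lambda>n. 1"])
  show "polytime (\<lambda>z. divmod_step (snd (fst z)) (snd z))"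
    unfolding divmod_step_def
    by (intro polytime_If polytime_eq polytime_Pair polytime_Suc polytime_const polytime_fst polytime_snd polytime_id)
  show "sz (divmod_step (snd x) r) \<le> sz r + 1" for x :: "nat \<times> nat" and r
    by (cases r) (simp add: divmod_step_def)
qed (intro pbound_intros polytime_const polytime_fst polytime_snd polytime_id)+

lemma polytime_div: "polytime f \<Longrightarrow> polytime g \<Longrightarrow> polytime (\<lambda>x. f x div (g x :: nat))"
  by (rule polytime_comp2[where F = "(div)", OF polytime_fst[OF polytime_divmod, unfolded fst_conv]])

lemma polytime_mod: "polytime f \<Longrightarrow> polytime g \<Longrightarrow> polytime (\<lambda>x. f x mod (g x :: nat))"
  by (rule polytime_comp2[where F = "(mod)", OF polytime_snd[OF polytime_divmod, unfolded snd_conv]])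

text \<open>Repeated halving avoids computing the power itself, whose unary code would be
  exponentially large.\<close>

lemma polytime_div_power2: "polytime f \<Longrightarrow> polytime g \<Longrightarrow> polytime (\<lambda>x. f x div 2 ^ g x :: nat)"
proof -
  assume fg: "polytime f" "polytime g"
  have div: "m div 2 ^ n = ((\<lambda>r. r div 2) ^^ n) m" for m n :: nat
    by (induction n) (auto simp: div_mult2_eq power_Suc2 simp del: power_Suc)
  show ?thesis unfolding div
    by (rule polytime_funpow[where B = "\<lambda>n. 0"])
      (intro fg pbound_intros polytime_div polytime_const polytime_snd polytime_id | simp)+
qed

lemmas polytime_intros = polytime_Pair polytime_If polytime_conj polytime_disj polytime_Not
  polytime_fst polytime_snd polytime_Cons polytime_Suc polytime_map polytime_filter polytime_Bex
  polytime_first polytime_length polytime_down polytime_add polytime_diff polytime_mult polytime_eq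
  polytime_less polytime_div polytime_mod polytime_div_power2 polytime_id polytime_const

section \<open>From polynomial-time functions to algorithms\<close>

lemma polytime_algorithm:
  fixes f :: "'a::enc \<Rightarrow> 'b::enc"
  assumes "polytime f"
  obtains A :: algorithm and p :: "nat poly"
  where "\<And>(x :: 'a) v. outputs A (code x) v \<Longrightarrow> v = code (f x)"
    and "\<And>x :: 'a. expected_time A (code x) \<le> of_nat (poly p (sz x))"
proof -
  obtain F B where F: "pbound B" "\<And>x. sz (f x) \<le> B (sz x)"
    "\<And>P Q x. calls (P @ F (length P) @ Q) (length P) [code x] (code (f x)) (B (sz x))"
    using assms by (rule polytimeE) blast
  obtain k where k: "\<And>n. B n \<le> (n + 2) ^ k" using F(1) by (rule pboundE) blast
  define A :: algorithm where "A = (F 0, ECall 0 [EVar 0])"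
  \<comment> \<open>One copy of (n + 2)^k pays for the steps, the other for the size of the result;
    the 2 pays for the initial call.\<close>
  define p :: "nat poly" where "p = 2 * [:2, 1:] ^ k + 2"
  have returns: "\<exists>t\<le>B (sz x) + 2. returns A (code x) \<omega> (code (f x)) t" for x :: 'a and \<omega>
  proof -
    have "runs (F 0) [code x] (EVar 0) (code x) 1" by (rule runs_Var) auto
    from runs_Call1[OF this F(3)[of "[]" "[]", simplified]]
    have "runs (F 0) [code x] (ECall 0 [EVar 0]) (code (f x)) (1 + B (sz x) + 1)" .
    then obtain t where "t \<le> 1 + B (sz x) + 1" "eval (F 0) [code x] (ECall 0 [EVar 0]) \<omega> (code (f x)) t \<omega>"
      unfolding runs_def by blast
    then show ?thesis unfolding returns_def A_def by (intro exI[of _ t]) auto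
  qed
  show thesis
  proof
    fix x :: 'a and v assume "outputs A (code x) v"
    then obtain \<omega> t where "returns A (code x) \<omega> v t" unfolding outputs_def by blast
    with returns[of x \<omega>] show "v = code (f x)" using returns_deterministic by blast
  next
    fix x :: 'a
    have "run_time A (code x) \<omega> \<le> of_nat (poly p (sz x))" for \<omega>
    proof -
      obtain t where t: "t \<le> B (sz x) + 2" "returns A (code x) \<omega> (code (f x)) t"
        using returns by blast
      have "t + sz (f x) \<le> 2 * (sz x + 2) ^ k + 2"
        using t(1) F(2)[of x] k[of "sz x"] by linarith
      also have "\<dots> = poly p (sz x)" by (simp add: p_def poly_power add.commute)
      finally show ?thesis unfolding run_time_eq[OF t(2)] by (rule of_nat_mono)
    qed
    \<comment> \<open>The bound holds for every coin stream, and a constant integrates to itself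
      over a probability space.\<close>
    then have "expected_time A (code x) \<le> (\<integral>\<^sup>+ \<omega>. of_nat (poly p (sz x)) \<partial>coin_space)"
      unfolding expected_time_def by (intro nn_integral_mono) auto
    also have "\<dots> = of_nat (poly p (sz x))"
      by (simp add: prob_space.emeasure_space_1[OF prob_space_coin_space])
    finally show "expected_time A (code x) \<le> of_nat (poly p (sz x))" .
  qed
qed


section \<open>The reduction\<close>

definition adj :: "(nat \<times> nat) list \<Rightarrow> nat \<Rightarrow> nat \<Rightarrow> bool" where
  "adj es u v \<longleftrightarrow> (\<exists>e\<in>set es. fst e = u \<and> snd e = v \<or> fst e = v \<and> snd e = u)"

text \<open>Distance at most 2. A vertex with a neighbour is near itself, hence the side conditions
  u \<noteq> v later on.\<close>

definition near :: "nat \<Rightarrow> (nat \<times> nat) list \<Rightarrow> nat \<Rightarrow> nat \<Rightarrow> bool" where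
  "near n es u v \<longleftrightarrow> adj es u v \<or> (\<exists>z\<in>set (down n). adj es u z \<and> adj es z v)"

definition free_color :: "nat \<Rightarrow> nat \<Rightarrow> (nat \<times> nat) list \<Rightarrow> (nat \<times> nat) list \<Rightarrow> nat \<Rightarrow> nat" where
  "free_color k n es cs v = first (\<lambda>a. \<not> (\<exists>p\<in>set cs. snd p = a \<and> near n es (fst p) v)) (down k) 0"

text \<open>The recursion works from the right: when v is colored, \<open>cs\<close> holds the
  colors of the vertices after it in the list.\<close>

definition greedy :: "nat \<Rightarrow> nat \<Rightarrow> (nat \<times> nat) list \<Rightarrow> nat list \<Rightarrow> (nat \<times> nat) list" where
  "greedy k n es vs = rec_list [] (\<lambda>v t cs. (v, free_color k n es cs v) # cs) vs"

definition color :: "nat \<Rightarrow> nat \<Rightarrow> (nat \<times> nat) list \<Rightarrow> nat \<Rightarrow> nat" where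
  "color k n es v = snd (first (\<lambda>p. fst p = v) (greedy k n es (down n)) (0, 0))"

definition partner :: "nat \<Rightarrow> nat \<Rightarrow> (nat \<times> nat) list \<Rightarrow> nat \<Rightarrow> nat \<Rightarrow> nat" where
  "partner k n es a v = first (\<lambda>u. adj es u v \<and> color k n es u = a) (down n) v"

text \<open>The number of binary digits (0 for n = 0), as the number of t with 2^t \<le> n.
  Searching below n is enough since t < 2^t.\<close>

definition nbits :: "nat \<Rightarrow> nat" where
  "nbits n = length (filter (\<lambda>t. n div 2 ^ t \<noteq> 0) (down n))"

text \<open>
  Attribute \<open>j\<close> encodes a bit value \<open>j mod 2\<close>, two colors \<open>a\<close> and \<open>b\<close>, and a bit position \<open>t\<close>, in
  mixed radix. It separates vertices of color \<open>a\<close> (the zeros) from vertices of color \<open>b\<close> (the ones).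
\<close>

definition zero_side :: "nat \<Rightarrow> nat \<Rightarrow> (nat \<times> nat) list \<Rightarrow> nat \<Rightarrow> nat \<Rightarrow> bool" where
  "zero_side k n es j v \<longleftrightarrow> color k n es v = j div 2 mod k \<and>
    v div 2 ^ (j div 2 div k div k) mod 2 = j mod 2"

definition one_side :: "nat \<Rightarrow> nat \<Rightarrow> (nat \<times> nat) list \<Rightarrow> nat \<Rightarrow> nat \<Rightarrow> bool" where
  "one_side k n es j v \<longleftrightarrow> color k n es v = j div 2 div k mod k \<and>
    \<not> partner k n es (j div 2 mod k) v div 2 ^ (j div 2 div k div k) mod 2 = j mod 2"

text \<open>Attributes are numbered from 1 and the first two carry the color, so separating
  attribute j gets number j + 3. The test v < n leaves the extra symbol, listed as vertex n, with
  attributes 1 and 2 only.\<close>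

definition symbol :: "nat \<Rightarrow> nat \<Rightarrow> (nat \<times> nat) list \<Rightarrow> nat \<Rightarrow> nat list" where
  "symbol k n es v = 1 # 2 # map (\<lambda>j. j + 3)
    (filter (\<lambda>j. v < n \<and> (zero_side k n es j v \<or> one_side k n es j v)) (down (2 * k * k * nbits n)))"

definition reduction :: "nat \<Rightarrow> nat \<times> (nat \<times> nat) list \<Rightarrow> nat \<times> nat list list" where
  "reduction k x = (2 + 2 * k * k * nbits (fst x), map (symbol k (fst x) (snd x)) (down (Suc (fst x))))"

section \<open>The reduction runs in polynomial time\<close>

lemma polytime_adj:
  "polytime es \<Longrightarrow> polytime u \<Longrightarrow> polytime v \<Longrightarrow> polytime (\<lambda>x. adj (es x) (u x) (v x))"
  by (rule polytime_comp3[where F = adj]) (unfold adj_def, (intro polytime_intros)+)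

lemma polytime_near:
  "polytime n \<Longrightarrow> polytime es \<Longrightarrow> polytime u \<Longrightarrow> polytime v \<Longrightarrow> polytime (\<lambda>x. near (n x) (es x) (u x) (v x))"
  by (rule polytime_comp4[where F = near]) (unfold near_def, (intro polytime_intros polytime_adj)+)

lemma polytime_free_color:
  "polytime n \<Longrightarrow> polytime es \<Longrightarrow> polytime cs \<Longrightarrow> polytime v \<Longrightarrow>
    polytime (\<lambda>x. free_color k (n x) (es x) (cs x) (v x))"
  by (rule polytime_comp4[where F = "free_color k"])
    (unfold free_color_def, (intro polytime_intros polytime_near)+)

text \<open>Serves as a size bound on arbitrary inputs, including those where no color is free and
  the default 0 is returned. For k = 0 the inequality is not strict.\<close>

lemma free_color_le: "free_color k n es cs v \<le> k"
proof (cases "\<exists>a\<in>set (down k). \<not> (\<exists>p\<in>set cs. snd p = a \<and> near n es (fst p) v)")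
  case True
  then have "free_color k n es cs v \<in> set (down k)"
    unfolding free_color_def by (elim bexE) (rule first_exists[THEN conjunct1])
  then show ?thesis by simp
next
  case False
  then show ?thesis unfolding free_color_def by (subst first_default) auto
qed

lemma polytime_color:
  "polytime n \<Longrightarrow> polytime es \<Longrightarrow> polytime v \<Longrightarrow> polytime (\<lambda>x. color k (n x) (es x) (v x))"
proof (rule polytime_comp3[where F = "color k"])
  have "polytime (\<lambda>p :: nat \<times> (nat \<times> nat) list \<times> nat. greedy k (fst p) (fst (snd p)) (down (fst p)))"
    unfolding greedy_def
  \<comment> \<open>A round adds a vertex, a color of size at most k, one pair node and one list
    node.\<close>
  proof (rule polytime_rec_list[where B = "\<lambda>n. n + (k + 2)"])
    show "sz ((a, free_color k (fst x) (fst (snd x)) r a) # r) \<le> sz r + (sz x + sz a + sz t + (k + 2))"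
      for x :: "nat \<times> (nat \<times> nat) list \<times> nat" and r a and t :: "nat list"
      using free_color_le[of k "fst x" "fst (snd x)" r a] by simp
  qed (intro polytime_intros pbound_intros polytime_free_color)+
  then show "polytime (\<lambda>p. color k (fst p) (fst (snd p)) (snd (snd p)))"
    unfolding color_def by (intro polytime_intros)
qed

lemma polytime_partner:
  "polytime n \<Longrightarrow> polytime es \<Longrightarrow> polytime a \<Longrightarrow> polytime v \<Longrightarrow>
    polytime (\<lambda>x. partner k (n x) (es x) (a x) (v x))"
  by (rule polytime_comp4[where F = "partner k"])
    (unfold partner_def, (intro polytime_intros polytime_adj polytime_color)+)

lemma polytime_nbits: "polytime n \<Longrightarrow> polytime (\<lambda>x. nbits (n x))"
  by (rule polytime_comp[where g = nbits]) (unfold nbits_def, (intro polytime_intros)+)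

lemma polytime_symbol:
  "polytime n \<Longrightarrow> polytime es \<Longrightarrow> polytime v \<Longrightarrow> polytime (\<lambda>x. symbol k (n x) (es x) (v x))"
  by (rule polytime_comp3[where F = "symbol k"])
    (unfold symbol_def zero_side_def one_side_def,
      (intro polytime_intros polytime_color polytime_partner polytime_nbits)+)

lemma polytime_reduction: "polytime (reduction k)"
proof -
  have "polytime (\<lambda>x. (2 + 2 * k * k * nbits (fst x), map (symbol k (fst x) (snd x)) (down (Suc (fst x)))))"
    by (intro polytime_intros polytime_symbol polytime_nbits)
  then show ?thesis by (simp only: reduction_def[abs_def])
qed

section \<open>Correctness of the reduction\<close>

text \<open>Encodings are indexed by positions, the argument below by vertices. As \<open>vs\<close>
  is distinct, different positions hold different vertices even if their symbols are equal
  sets.\<close>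

lemma bpcp_feasible_map_iff:
  assumes "distinct vs"
  shows "bpcp_feasible (d, map s vs) \<longleftrightarrow>
    (\<exists>c :: 'a \<Rightarrow> nat \<Rightarrow> nat. (\<forall>v\<in>set vs. c v \<in> s v \<rightarrow>\<^sub>E {0, 1}) \<and>
      (\<forall>u\<in>set vs. \<forall>v\<in>set vs. u \<noteq> v \<longrightarrow> (\<exists>i\<in>s u \<inter> s v. c u i \<noteq> c v i)))"
    (is "_ \<longleftrightarrow> (\<exists>c. ?P c)")
proof
  assume "bpcp_feasible (d, map s vs)"
  then obtain c where "feasible_encoding (d, map s vs) c"
    unfolding bpcp_feasible_def by blast
  then have c: "\<And>j. j < length vs \<Longrightarrow> c j \<in> s (vs ! j) \<rightarrow>\<^sub>E {0, 1}"
    "\<And>j k. j < length vs \<Longrightarrow> k < length vs \<Longrightarrow> j \<noteq> k \<Longrightarrow> \<exists>i\<in>s (vs ! j) \<inter> s (vs ! k). c j i \<noteq> c k i"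
    unfolding feasible_encoding_def by (auto simp del: One_nat_def)
  define pos where "pos v = (SOME j. j < length vs \<and> vs ! j = v)" for v
  have pos: "pos v < length vs" "vs ! pos v = v" if "v \<in> set vs" for v
    using someI_ex[of "\<lambda>j. j < length vs \<and> vs ! j = v"] that unfolding pos_def in_set_conv_nth by auto
  show "\<exists>c. ?P c"
  proof (intro exI[of _ "\<lambda>v. c (pos v)"] conjI ballI impI)
    show "c (pos v) \<in> s v \<rightarrow>\<^sub>E {0, 1}" if "v \<in> set vs" for v
      using c(1) pos[OF that] by metis
    show "\<exists>i\<in>s u \<inter> s v. c (pos u) i \<noteq> c (pos v) i" if "u \<in> set vs" "v \<in> set vs" "u \<noteq> v" for u v
      using c(2)[of "pos u" "pos v"] pos that by metis
  qed
next
  assume "\<exists>c. ?P c"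
  then obtain c where c: "?P c" ..
  have "feasible_encoding (d, map s vs) (\<lambda>j. c (vs ! j))"
    unfolding feasible_encoding_def split length_map
  proof (intro conjI allI impI)
    show "c (vs ! j) \<in> map s vs ! j \<rightarrow>\<^sub>E {0, 1}" if "j < length vs" for j
      using conjunct1[OF c] that by simp
    show "\<exists>i\<in>map s vs ! j \<inter> map s vs ! k. c (vs ! j) i \<noteq> c (vs ! k) i"
      if "j < length vs" "k < length vs" "j \<noteq> k" for j k
    proof -
      have "vs ! j \<noteq> vs ! k" using nth_eq_iff_index_eq[OF assms] that by simp
      with conjunct2[OF c] that show ?thesis by simp
    qed
  qed
  then show "bpcp_feasible (d, map s vs)" unfolding bpcp_feasible_def by blast
qed

text \<open>\<open>P\<close> and \<open>Q\<close> abstract from the two sides of an attribute, which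
  enter the equivalence only through the separation of edges and the covering of non-edges.\<close>

definition symbol_set :: "nat \<Rightarrow> nat \<Rightarrow> (nat \<Rightarrow> nat \<Rightarrow> bool) \<Rightarrow> (nat \<Rightarrow> nat \<Rightarrow> bool) \<Rightarrow> nat \<Rightarrow> nat set" where
  "symbol_set n M P Q v = {1, 2} \<union> {j + 3 | j. j < M \<and> v < n \<and> (P j v \<or> Q j v)}"

lemma edge_less:
  assumes "simple_graph {..<n} E" "{u, v} \<in> E"
  shows "u < n \<and> v < n \<and> u \<noteq> v"
proof -
  have "{u, v} \<subseteq> {..<n} \<and> card {u, v} = 2"
    using assms unfolding simple_graph_def by (elim conjE) (rule bspec)
  then show ?thesis by (auto simp: card_insert_if split: if_splits)
qed

text \<open>
  The vertex \<open>n\<close> is not a vertex of the graph: its symbol \<open>{1, 2}\<close> forbids one of the four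
  combinations on the attributes 1 and 2, and the other three are the colors.
\<close>

lemma feasible_iff_colorable:
  fixes P Q :: "nat \<Rightarrow> nat \<Rightarrow> bool"
  assumes graph: "simple_graph {..<n} E"
    and sep: "\<And>j u v. {u, v} \<in> E \<Longrightarrow> \<not> ((P j u \<or> Q j u) \<and> (P j v \<or> Q j v))"
    and cover: "\<And>u v. u < n \<Longrightarrow> v < n \<Longrightarrow> u \<noteq> v \<Longrightarrow> {u, v} \<notin> E \<Longrightarrow> \<exists>j<M. P j u \<and> Q j v \<and> \<not> P j v"
    and vs: "distinct vs" "set vs = {..<Suc n}"
  shows "bpcp_feasible (d, map (symbol_set n M P Q) vs) \<longleftrightarrow> colorable 3 {..<n} E"
    (is "bpcp_feasible (d, map ?s vs) \<longleftrightarrow> _")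
proof
  assume "bpcp_feasible (d, map ?s vs)"
  then have "\<exists>c :: nat \<Rightarrow> nat \<Rightarrow> nat. (\<forall>v\<in>{..n}. c v \<in> ?s v \<rightarrow>\<^sub>E {0, 1}) \<and>
    (\<forall>u\<in>{..n}. \<forall>v\<in>{..n}. u \<noteq> v \<longrightarrow> (\<exists>i\<in>?s u \<inter> ?s v. c u i \<noteq> c v i))"
    unfolding bpcp_feasible_map_iff[OF vs(1)] vs(2) lessThan_Suc_atMost .
  then obtain c where *: "(\<forall>v\<in>{..n}. c v \<in> ?s v \<rightarrow>\<^sub>E {0, 1 :: nat}) \<and>
    (\<forall>u\<in>{..n}. \<forall>v\<in>{..n}. u \<noteq> v \<longrightarrow> (\<exists>i\<in>?s u \<inter> ?s v. c u i \<noteq> c v i))" ..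
  have c: "c v \<in> ?s v \<rightarrow>\<^sub>E {0, 1}" if "v \<le> n" for v
    using conjunct1[OF *] that by simp
  have differ: "\<exists>i\<in>?s u \<inter> ?s v. c u i \<noteq> c v i" if "u \<le> n" "v \<le> n" "u \<noteq> v" for u v
    using conjunct2[OF *] that by simp
  define e where "e v = c v 1 + 2 * c v 2" for v
  have bits: "c v 1 \<in> {0, 1}" "c v 2 \<in> {0, 1}" if "v \<le> n" for v
    using PiE_mem[OF c[OF that], of 1] PiE_mem[OF c[OF that], of 2] unfolding symbol_set_def by blast+
  have less: "e v < 4" if "v \<le> n" for v
    using bits[OF that] by (auto simp: e_def)
  have neq: "e u \<noteq> e v" if "u \<le> n" "v \<le> n" "u \<noteq> v" "?s u \<inter> ?s v \<subseteq> {1, 2}" for u v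
  proof -
    from differ[OF that(1-3)] that(4) have "c u 1 \<noteq> c v 1 \<or> c u 2 \<noteq> c v 2" by blast
    then show ?thesis using bits[OF that(1)] bits[OF that(2)] unfolding e_def by auto
  qed
  have neq_n: "e v \<noteq> e n" if "v < n" for v
    by (rule neq) (use that in \<open>auto simp: symbol_set_def\<close>)
  \<comment> \<open>Closes the gap left in {0, 1, 2, 3} by the value of the extra symbol; this is
    injective on the other three values.\<close>
  define f where "f v = (if e v < e n then e v else e v - 1)" for v
  have "f \<in> {..<n} \<rightarrow> {..<3}"
  proof
    fix v assume "v \<in> {..<n}"
    then show "f v \<in> {..<3}" using less[of v] less[of n] neq_n[of v] by (auto simp: f_def)
  qed
  moreover have "f u \<noteq> f v" if "{u, v} \<in> E" for u v
  proof -
    have "\<forall>j. \<not> ((P j u \<or> Q j u) \<and> (P j v \<or> Q j v))" using sep[OF that] by simp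
    then have "?s u \<inter> ?s v \<subseteq> {1, 2}" by (auto simp: symbol_set_def)
    then have "e u \<noteq> e v" using edge_less[OF graph that] by (intro neq) auto
    then show ?thesis using neq_n[of u] neq_n[of v] edge_less[OF graph that] by (auto simp: f_def split: if_splits)
  qed
  ultimately show "colorable 3 {..<n} E" unfolding colorable_def proper_coloring_def by blast
next
  assume "colorable 3 {..<n} E"
  then obtain f :: "nat \<Rightarrow> nat" where f: "\<And>v. v < n \<Longrightarrow> f v < 3" "\<And>u v. {u, v} \<in> E \<Longrightarrow> f u \<noteq> f v"
    unfolding colorable_def proper_coloring_def by (auto simp: Pi_def)
  \<comment> \<open>The extra symbol takes the value 3, which no vertex has.\<close>
  define g where "g v = (if v < n then f v else 3)" for v
  have g_less: "g v < 4" for v using f(1)[of v] by (auto simp: g_def)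
  \<comment> \<open>The zero side is tested first, so v receives a one only if \<open>P\<close>
    fails for it; hence the last conjunct of the cover hypothesis.\<close>
  define c where "c v i = (if i \<notin> ?s v then undefined else if i = 1 then g v mod 2
    else if i = 2 then g v div 2 else if P (i - 3) v then 0 else 1)" for v i :: nat
  have "c v \<in> ?s v \<rightarrow>\<^sub>E {0, 1}" for v
  proof
    have "g v mod 2 \<in> {0, 1}" "g v div 2 \<in> {0, 1}" using g_less[of v] by auto
    then show "c v i \<in> {0, 1}" if "i \<in> ?s v" for i using that by (simp add: c_def)
  qed (simp add: c_def)
  moreover have "\<exists>i\<in>?s u \<inter> ?s v. c u i \<noteq> c v i" if "u \<le> n" "v \<le> n" "u \<noteq> v" for u v
  proof (cases "g u = g v")
    case False
    then have "g u mod 2 \<noteq> g v mod 2 \<or> g u div 2 \<noteq> g v div 2"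
      by (metis div_mult_mod_eq)
    then have "c u 1 \<noteq> c v 1 \<or> c u 2 \<noteq> c v 2" by (simp add: c_def symbol_set_def)
    moreover have "1 \<in> ?s u \<inter> ?s v" "2 \<in> ?s u \<inter> ?s v" by (auto simp: symbol_set_def)
    ultimately show ?thesis by blast
  next
    case True
    \<comment> \<open>Only the extra symbol has value 3, so u and v are both vertices of the graph.
      Having equal colors they are non-adjacent, and a separating attribute exists.\<close>
    then have uv: "u < n" "v < n"
      using that f(1)[of u] f(1)[of v] by (auto simp: g_def split: if_splits)
    then have "{u, v} \<notin> E" using True f(2) by (auto simp: g_def)
    from cover[OF uv that(3) this] obtain j where j: "j < M" "P j u" "Q j v" "\<not> P j v" by blast
    then have "j + 3 \<in> ?s u \<inter> ?s v" using uv by (auto simp: symbol_set_def)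
    moreover from this j have "c u (j + 3) \<noteq> c v (j + 3)" by (simp add: c_def)
    ultimately show ?thesis by blast
  qed
  ultimately show "bpcp_feasible (d, map ?s vs)"
    unfolding bpcp_feasible_map_iff[OF vs(1)] vs(2) lessThan_Suc_atMost by blast
qed

section \<open>Binary digits and the numbering of attributes\<close>

lemma finite_power2_le: "2 ^ t \<le> n \<Longrightarrow> t < (n :: nat)"
  using less_exp[of t] by (rule less_le_trans)

lemma nbits_eq_card: "nbits n = card {t. 2 ^ t \<le> n}"
proof -
  have "nbits n = card (set (filter (\<lambda>t. n div 2 ^ t \<noteq> 0) (down n)))"
    unfolding nbits_def by (rule distinct_card[symmetric]) simp
  also have "set (filter (\<lambda>t. n div 2 ^ t \<noteq> 0) (down n)) = {t. 2 ^ t \<le> n}"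
    by (auto simp: div_eq_0_iff not_less finite_power2_le)
  finally show ?thesis .
qed

text \<open>Otherwise the exponents from 0 to \<open>nbits n\<close> would all be counted, one more
  than there are.\<close>

lemma less_power2_nbits: "n < 2 ^ nbits n"
proof (rule ccontr)
  assume *: "\<not> n < 2 ^ nbits n"
  have "2 ^ t \<le> n" if "t \<le> nbits n" for t
    using power_increasing[OF that, of "2 :: nat"] * by linarith
  then have "{..nbits n} \<subseteq> {t. 2 ^ t \<le> n}" by auto
  moreover have "finite {t. 2 ^ t \<le> n}"
    by (rule finite_subset[of _ "{..<n}"]) (auto simp: finite_power2_le)
  ultimately have "card {..nbits n} \<le> card {t. 2 ^ t \<le> n}" by (intro card_mono)
  then show False by (simp add: nbits_eq_card)
qed

lemma nbits_le_log:
  assumes "n > 0"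
  shows "real (nbits n) \<le> log 2 (real n) + 1"
proof -
  have "2 ^ t \<le> n \<Longrightarrow> t \<le> nat \<lfloor>log 2 n\<rfloor>" for t
    using assms by (simp add: le_log_of_power le_nat_floor)
  then have "{t. 2 ^ t \<le> n} \<subseteq> {..nat \<lfloor>log 2 n\<rfloor>}" by auto
  then have "nbits n \<le> card {..nat \<lfloor>log 2 n\<rfloor>}"
    unfolding nbits_eq_card by (intro card_mono) auto
  then have "real (nbits n) \<le> real (nat \<lfloor>log 2 n\<rfloor>) + 1" by simp
  moreover have "real (nat \<lfloor>log 2 n\<rfloor>) \<le> log 2 n"
    using assms by (intro of_nat_floor) simp
  ultimately show ?thesis by linarith
qed

text \<open>Either the last bits differ, or the halves do and the induction continues with one bit
  fewer.\<close>

lemma exists_bit_differs: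
  assumes "u \<noteq> v" "u < 2 ^ L" "v < (2 ^ L :: nat)"
  shows "\<exists>t<L. u div 2 ^ t mod 2 \<noteq> v div 2 ^ t mod 2"
  using assms
proof (induction L arbitrary: u v)
  case (Suc L)
  show ?case
  proof (cases "u mod 2 = v mod 2")
    case False
    then show ?thesis by (intro exI[of _ 0]) simp
  next
    case True
    with Suc.prems(1) have "u div 2 \<noteq> v div 2" by (metis div_mult_mod_eq)
    moreover have "u div 2 < 2 ^ L" "v div 2 < 2 ^ L"
      using Suc.prems(2,3) by (simp_all add: less_mult_imp_div_less mult.commute)
    ultimately obtain t where "t < L" "u div 2 div 2 ^ t mod 2 \<noteq> v div 2 div 2 ^ t mod 2"
      using Suc.IH by blast
    then show ?thesis by (intro exI[of _ "Suc t"]) (simp add: div_mult2_eq)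
  qed
qed simp

lemma add_mult_less:
  assumes "a < k" "b < (l :: nat)"
  shows "a + k * b < k * l"
proof -
  have "a + k * b < k * Suc b" using assms(1) by simp
  also have "\<dots> \<le> k * l" using assms(2) by (intro mult_le_mono2) simp
  finally show ?thesis .
qed

lemma exists_attribute:
  assumes "\<beta> < 2" "a < k" "b < k" "t < (L :: nat)"
  shows "\<exists>j<2 * k * k * L. j mod 2 = \<beta> \<and> j div 2 mod k = a \<and> j div 2 div k mod k = b \<and> j div 2 div k div k = t"
proof (intro exI conjI)
  have digit: "(d + m * x) mod m = d" "(d + m * x) div m = x" if "d < m" for d m x :: nat
    using that by simp_all
  \<comment> \<open>Horner form of the digits \<beta>, a, b, t in the radices 2, k, k, L.\<close>
  let ?j = "\<beta> + 2 * (a + k * (b + k * t))"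
  show "?j < 2 * k * k * L"
    using add_mult_less[OF assms(1) add_mult_less[OF assms(2) add_mult_less[OF assms(3,4)]]] by (simp only: mult.assoc)
  show "?j mod 2 = \<beta>" "?j div 2 mod k = a" "?j div 2 div k mod k = b" "?j div 2 div k div k = t"
    by (simp_all only: digit[OF assms(1)] digit[OF assms(2)] digit[OF assms(3)])
qed

section \<open>The auxiliary coloring at distance 2\<close>

lemma adj_sym: "adj es u v \<longleftrightarrow> adj es v u"
  unfolding adj_def by blast

lemma near_sym: "near n es u v \<longleftrightarrow> near n es v u"
  unfolding near_def using adj_sym by blast

lemma adj_iff_edge: "edge_list es E \<Longrightarrow> adj es u v \<longleftrightarrow> {u, v} \<in> E"
proof -
  assume "edge_list es E"
  then have E: "E = (\<lambda>e. {fst e, snd e}) ` set es"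
    unfolding edge_list_def by (simp add: case_prod_beta')
  show ?thesis unfolding E adj_def image_iff doubleton_eq_iff by (intro bex_cong) auto
qed

lemma greedy_Cons: "greedy k n es (v # vs) = (v, free_color k n es (greedy k n es vs) v) # greedy k n es vs"
  by (simp add: greedy_def)

text \<open>When v is reached, fewer than k other vertices are near it, so the colors already given
  to them leave one free. Listing each vertex once makes \<open>fst\<close> injective on the
  entries, so entries can be counted as vertices.\<close>

lemma greedy_proper:
  assumes "distinct vs" "set vs \<subseteq> {..<n}"
    and "\<And>v. v < n \<Longrightarrow> card {u. u < n \<and> u \<noteq> v \<and> near n es u v} < k"
  shows "map fst (greedy k n es vs) = vs \<and> snd ` set (greedy k n es vs) \<subseteq> {..<k} \<and>
    (\<forall>p\<in>set (greedy k n es vs). \<forall>q\<in>set (greedy k n es vs).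
      fst p \<noteq> fst q \<longrightarrow> near n es (fst p) (fst q) \<longrightarrow> snd p \<noteq> snd q)"
  using assms(1,2)
proof (induction vs)
  case (Cons v vs)
  define cs where "cs = greedy k n es vs"
  define a where "a = free_color k n es cs v"
  have IH: "map fst cs = vs" "snd ` set cs \<subseteq> {..<k}"
    "\<And>p q. p \<in> set cs \<Longrightarrow> q \<in> set cs \<Longrightarrow> fst p \<noteq> fst q \<Longrightarrow> near n es (fst p) (fst q) \<Longrightarrow> snd p \<noteq> snd q"
    using Cons unfolding cs_def by auto
  have fst_cs: "fst ` set cs = set vs" using IH(1) by (metis list.set_map)
  let ?N = "{p \<in> set cs. near n es (fst p) v}"
  have "distinct (map fst cs)" using IH(1) Cons.prems(1) by simp
  then have inj: "inj_on fst ?N" unfolding distinct_map by (auto intro: inj_on_subset)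
  have "card (snd ` ?N) \<le> card ?N" by (rule card_image_le) simp
  also have "\<dots> = card (fst ` ?N)" by (rule card_image[OF inj, symmetric])
  also have "\<dots> \<le> card {u. u < n \<and> u \<noteq> v \<and> near n es u v}"
    using Cons.prems fst_cs by (intro card_mono) auto
  also have "\<dots> < k" using Cons.prems by (intro assms(3)) auto
  finally have "\<not> {..<k} \<subseteq> snd ` ?N" using card_mono[of "snd ` ?N" "{..<k}"] by auto
  then obtain b where "b < k" "b \<notin> snd ` ?N" by blast
  then have a: "a \<in> set (down k) \<and> \<not> (\<exists>p\<in>set cs. snd p = a \<and> near n es (fst p) v)"
    unfolding a_def free_color_def by (intro first_exists[of b]) auto
  then have "near n es (fst p) v \<or> near n es v (fst p) \<Longrightarrow> snd p \<noteq> a" if "p \<in> set cs" for p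
    using that near_sym[of n es v] by blast
  moreover have "greedy k n es (v # vs) = (v, a) # cs" by (simp add: greedy_Cons cs_def a_def)
  ultimately show ?case using IH a by (auto dest: not_sym)
qed (simp add: greedy_def)

lemma color_proper:
  assumes "\<And>v. v < n \<Longrightarrow> card {u. u < n \<and> u \<noteq> v \<and> near n es u v} < k"
  shows "v < n \<Longrightarrow> color k n es v < k"
    and "u < n \<Longrightarrow> v < n \<Longrightarrow> u \<noteq> v \<Longrightarrow> near n es u v \<Longrightarrow> color k n es u \<noteq> color k n es v"
proof -
  define cs where "cs = greedy k n es (down n)"
  have cs: "map fst cs = down n" "snd ` set cs \<subseteq> {..<k}"
    "\<And>p q. p \<in> set cs \<Longrightarrow> q \<in> set cs \<Longrightarrow> fst p \<noteq> fst q \<Longrightarrow> near n es (fst p) (fst q) \<Longrightarrow> snd p \<noteq> snd q"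
    using greedy_proper[of "down n" n es k] assms unfolding cs_def by auto
  have *: "(v, color k n es v) \<in> set cs" if "v < n" for v
  proof -
    have "v \<in> fst ` set cs" using that cs(1) by (metis list.set_map set_down lessThan_iff)
    then obtain p where "p \<in> set cs" "fst p = v" by blast
    from first_exists[of p cs "\<lambda>p. fst p = v" "(0, 0)", OF this]
    show ?thesis unfolding color_def cs_def[symmetric] by (metis prod.collapse)
  qed
  show "color k n es v < k" if "v < n" using *[OF that] cs(2) by auto
  show "color k n es u \<noteq> color k n es v" if "u < n" "v < n" "u \<noteq> v" "near n es u v"
    using cs(3)[OF *[OF that(1)] *[OF that(2)]] that by simp
qed

text \<open>There are at most c neighbours, each with at most c neighbours of its own.\<close>

lemma card_near_less:
  assumes graph: "simple_graph {..<n} E" and es: "edge_list es E"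
    and deg: "max_degree_le {..<n} E c" and v: "v < n"
  shows "card {u. u < n \<and> u \<noteq> v \<and> near n es u v} < c * c + c + 1"
proof -
  define N where "N w = {u. adj es u w}" for w
  have adj: "adj es u w \<Longrightarrow> {u, w} \<in> E" "adj es u w \<Longrightarrow> u < n \<and> w < n \<and> u \<noteq> w" for u w
    using adj_iff_edge[OF es] edge_less[OF graph] by blast+
  have fin: "finite (N w)" for w
    by (rule finite_subset[of _ "{..<n}"]) (use adj in \<open>auto simp: N_def\<close>)
  have "E \<subseteq> Pow {..<n}" using graph unfolding simple_graph_def by blast
  then have "finite E" by (rule finite_subset) simp
  have N: "card (N w) \<le> c" if "w < n" for w
  proof -
    \<comment> \<open>Neighbours of w are counted by the edges at w.\<close>
    have inj: "inj_on (\<lambda>u. {u, w}) (N w)"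
      by (rule inj_onI) (simp add: doubleton_eq_iff, blast)
    have "card (N w) = card ((\<lambda>u. {u, w}) ` N w)" by (rule card_image[OF inj, symmetric])
    also have "\<dots> \<le> degree_in E w"
      unfolding degree_in_def using \<open>finite E\<close> adj(1) by (intro card_mono) (auto simp: N_def)
    also have "\<dots> \<le> c" using deg that unfolding max_degree_le_def by simp
    finally show ?thesis .
  qed
  have "{u. u < n \<and> u \<noteq> v \<and> near n es u v} \<subseteq> N v \<union> (\<Union>z\<in>N v. N z)"
    unfolding near_def N_def by auto
  then have "card {u. u < n \<and> u \<noteq> v \<and> near n es u v} \<le> card (N v \<union> (\<Union>z\<in>N v. N z))"
    using fin by (intro card_mono) auto
  also have "\<dots> \<le> card (N v) + card (\<Union>z\<in>N v. N z)" by (rule card_Un_le)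
  also have "card (\<Union>z\<in>N v. N z) \<le> (\<Sum>z\<in>N v. card (N z))" by (rule card_UN_le[OF fin])
  also have "(\<Sum>z\<in>N v. card (N z)) \<le> (\<Sum>z\<in>N v. c)"
    by (rule sum_mono) (use N adj in \<open>auto simp: N_def\<close>)
  also have "card (N v) + (\<Sum>z\<in>N v. c) \<le> c + c * c"
    using N[OF v] by (simp add: add_mono)
  finally show ?thesis by simp
qed

section \<open>Partners and the separating attributes\<close>

lemma partner_neighbor:
  assumes proper: "\<And>u v. u < n \<Longrightarrow> v < n \<Longrightarrow> u \<noteq> v \<Longrightarrow> near n es u v \<Longrightarrow> color k n es u \<noteq> color k n es v"
    and "u < n" "v < n" "adj es u v"
  shows "partner k n es (color k n es u) v = u"
proof (rule ccontr)
  define w where "w = partner k n es (color k n es u) v"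
  assume "partner k n es (color k n es u) v \<noteq> u"
  then have "u \<noteq> w" unfolding w_def by (rule not_sym)
  have w: "w \<in> set (down n) \<and> adj es w v \<and> color k n es w = color k n es u"
    unfolding w_def partner_def by (rule first_exists[of u]) (use assms in auto)
  \<comment> \<open>Both are neighbours of v, hence at distance at most 2, yet have the same color.
    So v has only one neighbour of that color.\<close>
  then have "near n es u w"
    unfolding near_def using assms(3,4) adj_sym[of es w v] by auto
  with proper[of u w] w \<open>u \<noteq> w\<close> assms(2) show False by auto
qed

lemma partner_cases: "partner k n es a v = v \<or> adj es (partner k n es a v) v \<and> color k n es (partner k n es a v) = a"
proof (cases "\<exists>u\<in>set (down n). adj es u v \<and> color k n es u = a")
  case True
  then obtain u where "u \<in> set (down n)" "adj es u v \<and> color k n es u = a" ..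
  from first_exists[of u "down n" "\<lambda>u. adj es u v \<and> color k n es u = a", OF this]
  show ?thesis unfolding partner_def by blast
next
  case False
  then show ?thesis unfolding partner_def by (intro disjI1 first_default) blast
qed

text \<open>Two vertices on the same side would have equal colors, which adjacent vertices do not.
  On opposite sides, the partner of the second is the first, whose bit would have to both equal and
  differ from j mod 2.\<close>

lemma sides_separate_edge:
  assumes proper: "\<And>u v. u < n \<Longrightarrow> v < n \<Longrightarrow> u \<noteq> v \<Longrightarrow> near n es u v \<Longrightarrow> color k n es u \<noteq> color k n es v"
    and "u < n" "v < n" "u \<noteq> v" "adj es u v"
  shows "\<not> ((zero_side k n es j u \<or> one_side k n es j u) \<and> (zero_side k n es j v \<or> one_side k n es j v))"
proof -
  have uv: "partner k n es (color k n es u) v = u"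
    by (rule partner_neighbor) (fact assms)+
  have vu: "partner k n es (color k n es v) u = v"
    by (rule partner_neighbor, erule (3) proper) (use assms(2-5) adj_sym[of es v u] in auto)
  have "color k n es u \<noteq> color k n es v"
    using assms(2-5) by (intro proper) (auto simp: near_def)
  then have "\<not> (zero_side k n es j u \<and> zero_side k n es j v)" "\<not> (one_side k n es j u \<and> one_side k n es j v)"
    unfolding zero_side_def one_side_def by metis+
  moreover have "\<not> (zero_side k n es j u \<and> one_side k n es j v)"
    using uv unfolding zero_side_def one_side_def by auto
  moreover have "\<not> (zero_side k n es j v \<and> one_side k n es j u)"
    using vu unfolding zero_side_def one_side_def by auto
  ultimately show ?thesis by blast
qed

lemma sides_cover_nonedge:
  assumes proper: "\<And>u v. u < n \<Longrightarrow> v < n \<Longrightarrow> u \<noteq> v \<Longrightarrow> near n es u v \<Longrightarrow> color k n es u \<noteq> color k n es v"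
    and less: "\<And>v. v < n \<Longrightarrow> color k n es v < k"
    and adj_less: "\<And>u v. adj es u v \<Longrightarrow> u < n \<and> v < n \<and> u \<noteq> v"
    and uv: "u < n" "v < n" "u \<noteq> v" "\<not> adj es u v"
  shows "\<exists>j<2 * k * k * nbits n. zero_side k n es j u \<and> one_side k n es j v \<and> \<not> zero_side k n es j v"
proof -
  define w where "w = partner k n es (color k n es u) v"
  have w: "w = v \<or> adj es w v \<and> color k n es w = color k n es u"
    unfolding w_def by (rule partner_cases)
  \<comment> \<open>The partner w is v or a neighbour of v, and u is neither.\<close>
  have "u \<noteq> w" "w < n" using w uv adj_less by auto
  then obtain t where t: "t < nbits n" "u div 2 ^ t mod 2 \<noteq> w div 2 ^ t mod 2"
    using exists_bit_differs[of u w "nbits n"] uv(1) less_power2_nbits[of n] by (meson less_trans)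
  obtain j where j: "j < 2 * k * k * nbits n" "j mod 2 = u div 2 ^ t mod 2"
    "j div 2 mod k = color k n es u" "j div 2 div k mod k = color k n es v" "j div 2 div k div k = t"
    using exists_attribute[of "u div 2 ^ t mod 2" "color k n es u" k "color k n es v" t "nbits n"]
      less uv t(1) by auto
  have "zero_side k n es j u" unfolding zero_side_def j by simp
  moreover have "one_side k n es j v"
    unfolding one_side_def j w_def[symmetric] using t(2) by simp
  \<comment> \<open>Were v on the zero side, it would share the color of u and its bit t, so w would
    differ from v. Then w would be a neighbour of v with the color of v.\<close>
  moreover have "\<not> zero_side k n es j v"
  proof
    assume "zero_side k n es j v"
    then have *: "color k n es v = color k n es u" "v div 2 ^ t mod 2 = u div 2 ^ t mod 2"
      unfolding zero_side_def j by simp_all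
    then have "w \<noteq> v" using t(2) by auto
    with w have "adj es w v" "color k n es w = color k n es v" using * by auto
    then show False using proper[of w v] \<open>w < n\<close> \<open>w \<noteq> v\<close> uv(2) by (simp add: near_def)
  qed
  ultimately show ?thesis using j(1) by blast
qed

lemma set_symbol:
  "set (symbol k n es v) = symbol_set n (2 * k * k * nbits n) (zero_side k n es) (one_side k n es) v"
  unfolding symbol_def symbol_set_def by auto

section \<open>Growth of the attribute count and assembly of the reduction\<close>

lemma nbits_bigo: "(\<lambda>n. real (2 + m * nbits n)) \<in> O(\<lambda>n. (log 2 (real n))\<^sup>2)"
proof (rule bigoI)
  show "\<forall>\<^sub>F n in at_top. norm (real (2 + m * nbits n)) \<le> real (2 + 2 * m) * norm ((log 2 (real n))\<^sup>2)"
    using eventually_ge_at_top[of 2]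
  proof eventually_elim
    case (elim n)
    define l where "l = log 2 (real n)"
    \<comment> \<open>From n \<ge> 2 on, both 1 and l are at most the square of l, so the linear
      bound on \<open>nbits\<close> fits under it.\<close>
    have "1 \<le> l" using elim by (simp add: l_def le_log_iff)
    then have l: "l \<le> l\<^sup>2" "1 \<le> l\<^sup>2" using self_le_power[of l 2] one_le_power[of l 2] by simp_all
    have "real (nbits n) \<le> 2 * l\<^sup>2" using nbits_le_log[of n, folded l_def] elim l by linarith
    then have "real m * real (nbits n) \<le> real m * (2 * l\<^sup>2)" by (rule mult_left_mono) simp
    then show ?case using l unfolding l_def[symmetric] by (simp add: algebra_simps)
  qed
qed

theorem theorem3:
  fixes c :: nat
  shows "\<exists>(A :: algorithm) (num_symbols :: nat \<Rightarrow> nat) (num_attributes :: nat \<Rightarrow> nat).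
    (\<lambda>n. real (num_symbols n)) \<in> O(\<lambda>n. real n) \<and>
    (\<lambda>n. real (num_attributes n)) \<in> O(\<lambda>n. (log 2 (real n))\<^sup>2) \<and>
    expected_polytime_on {x. \<exists>n E. codes_graph x n E \<and> max_degree_le {..<n} E c} A \<and>
    (\<forall>n E x v. codes_graph x n E \<and> max_degree_le {..<n} E c \<and> outputs A x v \<longrightarrow>
      (\<exists>d S. codes_bpcp v (d, S) \<and> bpcp_instance (d, S) \<and>
        length S \<le> num_symbols n \<and> d \<le> num_attributes n \<and>
        (bpcp_feasible (d, S) \<longleftrightarrow> colorable 3 {..<n} E)))"
proof -
  \<comment> \<open>One color more than the number of other vertices within distance 2.\<close>
  define k where "k = c * c + c + 1"
  obtain A p where A: "\<And>x v. outputs A (code x) v \<Longrightarrow> v = code (reduction k x)"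
    "\<And>x :: nat \<times> (nat \<times> nat) list. expected_time A (code x) \<le> of_nat (poly p (sz x))"
    using polytime_algorithm[OF polytime_reduction] by blast
  \<comment> \<open>The overloaded \<open>code\<close> agrees with the prescribed coding of
    graphs.\<close>
  have input: "\<exists>es. edge_list es E \<and> x = code (n, es)" if "codes_graph x n E" for x n E
    using that unfolding codes_graph_def code_prod_def code_list_def code_nat_def by blast
  show ?thesis
  \<comment> \<open>One symbol per vertex and the extra one; two color attributes and one for each
    choice of a bit value, two auxiliary colors and a bit position.\<close>
  proof (rule exI[of _ A], rule exI[of _ Suc], rule exI[of _ "\<lambda>n. 2 + 2 * k * k * nbits n"], intro conjI allI impI)
    show "(\<lambda>n. real (Suc n)) \<in> O(\<lambda>n. real n)"
      by (intro bigoI[of _ 2] eventually_mono[OF eventually_ge_at_top[of 1]]) auto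
    show "(\<lambda>n. real (2 + 2 * k * k * nbits n)) \<in> O(\<lambda>n. (log 2 (real n))\<^sup>2)"
      by (rule nbits_bigo)
    show "expected_polytime_on {x. \<exists>n E. codes_graph x n E \<and> max_degree_le {..<n} E c} A"
      unfolding expected_polytime_on_def
    proof (intro exI ballI)
      fix x assume "x \<in> {x. \<exists>n E. codes_graph x n E \<and> max_degree_le {..<n} E c}"
      then obtain n es where "x = code (n :: nat, es :: (nat \<times> nat) list)" using input by blast
      then show "expected_time A x \<le> of_nat (poly p (size x))" using A(2)[of "(n, es)"] by (simp only:)
    qed
    fix n E x v
    assume asm: "codes_graph x n E \<and> max_degree_le {..<n} E c \<and> outputs A x v"
    then obtain es where es: "edge_list es E" and x: "x = code (n, es)" using input by blast
    have graph: "simple_graph {..<n} E" and deg: "max_degree_le {..<n} E c"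
      using asm by (auto simp: codes_graph_def)
    define M where "M = 2 * k * k * nbits n"
    define ss where "ss = map (symbol k n es) (down (Suc n))"
    have v: "v = code (2 + M, ss)"
      using A(1)[of "(n, es)" v] asm unfolding x reduction_def ss_def M_def by simp
    have S: "map set ss = map (symbol_set n M (zero_side k n es) (one_side k n es)) (down (Suc n))"
      unfolding ss_def M_def by (simp add: set_symbol)
    have few: "card {u. u < n \<and> u \<noteq> v \<and> near n es u v} < k" if "v < n" for v
      unfolding k_def by (rule card_near_less[OF graph es deg that])
    have less: "color k n es v < k" if "v < n" for v
      by (rule color_proper(1)[OF few that])
    have proper: "color k n es u \<noteq> color k n es v" if "u < n" "v < n" "u \<noteq> v" "near n es u v" for u v
      by (rule color_proper(2)[OF few that])
    have adj: "adj es u v \<longleftrightarrow> {u, v} \<in> E" for u v by (rule adj_iff_edge[OF es])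
    have feasible: "bpcp_feasible (2 + M, map set ss) \<longleftrightarrow> colorable 3 {..<n} E"
      unfolding S
    proof (rule feasible_iff_colorable[OF graph])
      show "\<not> ((zero_side k n es j u \<or> one_side k n es j u) \<and> (zero_side k n es j v \<or> one_side k n es j v))"
        if "{u, v} \<in> E" for j u v
        using edge_less[OF graph that] that adj
        by (intro sides_separate_edge proper) auto
      show "\<exists>j<M. zero_side k n es j u \<and> one_side k n es j v \<and> \<not> zero_side k n es j v"
        if "u < n" "v < n" "u \<noteq> v" "{u, v} \<notin> E" for u v
        unfolding M_def using that adj edge_less[OF graph]
        by (intro sides_cover_nonedge proper less) auto
    qed auto
    show "\<exists>d S. codes_bpcp v (d, S) \<and> bpcp_instance (d, S) \<and>
        length S \<le> Suc n \<and> d \<le> 2 + 2 * k * k * nbits n \<and> (bpcp_feasible (d, S) \<longleftrightarrow> colorable 3 {..<n} E)"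
    proof (intro exI conjI)
      show "codes_bpcp v (2 + M, map set ss)"
        unfolding codes_bpcp_def v code_prod_def code_list_def code_nat_def by auto
      show "bpcp_instance (2 + M, map set ss)"
        unfolding bpcp_instance_def S by (auto simp: symbol_set_def)
      show "length (map set ss) \<le> Suc n" by (simp add: ss_def)
      show "2 + M \<le> 2 + 2 * k * k * nbits n" by (simp add: M_def)
    qed (rule feasible)
  qed
qed

end
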